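(* Unless the Exponential Time Hypothesis fails, there is no algorithm that solves WSP restricted to instances in which all constraints are user-independent in time $O^*(2^{o(k\log k)})$, where $k$ is the number of tasks.
   Context: An instance of WSP is a tuple $(S,U,A,C)$: $S$ a finite set of tasks ($k=|S|$), $U$ a finite set of users ($n=|U|$), $A(s)\subseteq U$ the authorization list of $s\in S$ (arbitrary), $C$ a set of constraints ($m=|C|$); a constraint is a pair $(L,\Theta)$ with $L\subseteq S$ and $\Theta$ a set of functions $L\to U$. A plan $\pi:T\to X$ ($T\subseteq S$, $X\subseteq U$) satisfies $(L,\Theta)$ if $L\setminus T\neq\emptyset$ or $\pi|_L\in\Theta$; it is eligible if it satisfies all constraints, authorized if $\pi(s)\in A(s)$ for all $s\in T$, valid if both, complete if it is a plan $S\to U$. WSP asks whether a valid complete plan exists (and to output one if so). A constraint $(L,\Theta)$ is user-independent if $\psi\circ\theta\in\Theta$ for all $\theta\in\Theta$ and all permutations $\psi$ of $U$. $O^*(h)$ means $O(q(n,k,m)h)$ for a polynomial $q$. The Exponential Time Hypothesis (ETH) states that there is no algorithm solving 3-SAT on $N$ variables in time $O^*(2^{o(N)})$. *)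

theory Defs
  imports
    Complex_Main
    "HOL-Library.FuncSet"
    "HOL-Library.Landau_Symbols"
    "HOL-Combinatorics.Permutations"
begin

section \<open>Algorithms and running time\<close>

text \<open>
  Algorithms are the programs of the WHILE language over binary trees (N. D. Jones,
  \<^emph>\<open>Computability and Complexity from a Programming Perspective\<close>): trees are the only data,
  and every elementary operation costs one step. Since trees can be shared and there is no
  built-in comparison of trees, this cost measure is polynomially related to
  (deterministic) Turing machine time, and bounds of the form \<open>O*(2^o(g))\<close> are insensitive to
  polynomial changes of the machine model.
\<close>

datatype val = Nl | Pr val val

datatype expr = Var nat | NlE | PrE expr expr | Hd expr | Tl expr

datatype com = Skip | Assign nat expr | Seq com com | If expr com com | While expr com

type_synonym state = "nat \<Rightarrow> val"

fun hd_val :: "val \<Rightarrow> val" where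
  "hd_val Nl = Nl"
| "hd_val (Pr a b) = a"

fun tl_val :: "val \<Rightarrow> val" where
  "tl_val Nl = Nl"
| "tl_val (Pr a b) = b"

fun eval_expr :: "expr \<Rightarrow> state \<Rightarrow> val" where
  "eval_expr (Var x) s = s x"
| "eval_expr NlE s = Nl"
| "eval_expr (PrE e f) s = Pr (eval_expr e s) (eval_expr f s)"
| "eval_expr (Hd e) s = hd_val (eval_expr e s)"
| "eval_expr (Tl e) s = tl_val (eval_expr e s)"

fun cost :: "expr \<Rightarrow> nat" where
  "cost (Var x) = 1"
| "cost NlE = 1"
| "cost (PrE e f) = 1 + cost e + cost f"
| "cost (Hd e) = 1 + cost e"
| "cost (Tl e) = 1 + cost e"

text \<open>
  \<open>exec c s t s'\<close>: command \<open>c\<close> started in state \<open>s\<close> halts after exactly \<open>t\<close> steps in state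
  \<open>s'\<close>. As a truth value, \<^const>\<open>Nl\<close> is false and every other tree is true.
\<close>

inductive exec :: "com \<Rightarrow> state \<Rightarrow> nat \<Rightarrow> state \<Rightarrow> bool" where
  Skip: "exec Skip s 1 s"
| Assign: "exec (Assign x e) s (1 + cost e) (s(x := eval_expr e s))"
| Seq: "exec c\<^sub>1 s\<^sub>1 t\<^sub>1 s\<^sub>2 \<Longrightarrow> exec c\<^sub>2 s\<^sub>2 t\<^sub>2 s\<^sub>3 \<Longrightarrow> exec (Seq c\<^sub>1 c\<^sub>2) s\<^sub>1 (t\<^sub>1 + t\<^sub>2) s\<^sub>3"
| IfTrue: "eval_expr e s \<noteq> Nl \<Longrightarrow> exec c\<^sub>1 s t s' \<Longrightarrow> exec (If e c\<^sub>1 c\<^sub>2) s (1 + cost e + t) s'"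
| IfFalse: "eval_expr e s = Nl \<Longrightarrow> exec c\<^sub>2 s t s' \<Longrightarrow> exec (If e c\<^sub>1 c\<^sub>2) s (1 + cost e + t) s'"
| WhileFalse: "eval_expr e s = Nl \<Longrightarrow> exec (While e c) s (1 + cost e) s"
| WhileTrue: "eval_expr e s\<^sub>1 \<noteq> Nl \<Longrightarrow> exec c s\<^sub>1 t\<^sub>1 s\<^sub>2 \<Longrightarrow> exec (While e c) s\<^sub>2 t\<^sub>2 s\<^sub>3
    \<Longrightarrow> exec (While e c) s\<^sub>1 (1 + cost e + t\<^sub>1 + t\<^sub>2) s\<^sub>3"

lemma exec_deterministic:
  "exec c s t s' \<Longrightarrow> exec c s u s'' \<Longrightarrow> t = u \<and> s' = s''"
proof (induction arbitrary: u s'' rule: exec.induct)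
  case (Seq c\<^sub>1 s\<^sub>1 t\<^sub>1 s\<^sub>2 c\<^sub>2 t\<^sub>2 s\<^sub>3)
  from Seq.prems show ?case by cases (use Seq.IH in blast)
next
  case (WhileTrue e s\<^sub>1 c t\<^sub>1 s\<^sub>2 t\<^sub>2 s\<^sub>3)
  from WhileTrue.prems show ?case by cases (use WhileTrue in blast)+
qed (erule exec.cases; fastforce)+

text \<open>Input and output are passed in variable 0; all other variables are initially \<^const>\<open>Nl\<close>.\<close>

definition runs :: "com \<Rightarrow> val \<Rightarrow> nat \<Rightarrow> val \<Rightarrow> bool" where
  "runs P x t y \<longleftrightarrow> (\<exists>s. exec P ((\<lambda>_. Nl)(0 := x)) t s \<and> s 0 = y)"

text \<open>\<open>polynomial_in X q\<close>: \<open>q\<close> is a polynomial with real coefficients in the numerical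
  parameters \<open>X\<close> of the inputs.\<close>

inductive polynomial_in :: "('i \<Rightarrow> nat) set \<Rightarrow> ('i \<Rightarrow> real) \<Rightarrow> bool"
  for X :: "('i \<Rightarrow> nat) set" where
  const: "polynomial_in X (\<lambda>_. c)"
| param: "p \<in> X \<Longrightarrow> polynomial_in X (\<lambda>i. real (p i))"
| add: "polynomial_in X q \<Longrightarrow> polynomial_in X r \<Longrightarrow> polynomial_in X (\<lambda>i. q i + r i)"
| mult: "polynomial_in X q \<Longrightarrow> polynomial_in X r \<Longrightarrow> polynomial_in X (\<lambda>i. q i * r i)"

text \<open>
  A computational problem is given by the set \<open>D\<close> of its inputs, which are pairs of an instance
  and a tree encoding it, and a relation \<open>ans\<close> between instances and correct outputs.
  \<open>solvable_in_Ostar D ans X h\<close>: some program solves the problem in time \<open>O(q h)\<close> for a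
  polynomial \<open>q\<close> in the parameters \<open>X\<close>.
\<close>

definition solvable_in_Ostar ::
  "('i \<times> val) set \<Rightarrow> ('i \<Rightarrow> val \<Rightarrow> bool) \<Rightarrow> ('i \<times> val \<Rightarrow> nat) set \<Rightarrow> ('i \<times> val \<Rightarrow> real) \<Rightarrow> bool"
where
  "solvable_in_Ostar D ans X h \<longleftrightarrow>
     (\<exists>P q C. polynomial_in X q \<and>
       (\<forall>(I, x) \<in> D. \<exists>t y. runs P x t y \<and> ans I y \<and> real t \<le> C * (q (I, x) * h (I, x))))"

fun enc_list :: "('a \<Rightarrow> val) \<Rightarrow> 'a list \<Rightarrow> val" where
  "enc_list f [] = Nl"
| "enc_list f (a # as) = Pr (f a) (enc_list f as)"

text \<open>Numbers are encoded in unary; they only occur as names of (and as the number of) tasks,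
  users and propositional variables.\<close>

definition enc_nat :: "nat \<Rightarrow> val" where
  "enc_nat n = enc_list (\<lambda>_. Nl) [0..<n]"

definition enc_bool :: "bool \<Rightarrow> val" where
  "enc_bool b = (if b then Pr Nl Nl else Nl)"

section \<open>3-SAT and the Exponential Time Hypothesis\<close>

text \<open>\<open>(b, v)\<close> is the literal that is true iff variable \<open>v\<close> has value \<open>b\<close>. The literals of a
  clause need not be distinct, so clauses with fewer than three literals are covered.\<close>

type_synonym literal = "bool \<times> nat"
type_synonym clause = "literal \<times> literal \<times> literal"
type_synonym formula = "nat \<times> clause list"

fun sat_literal :: "(nat \<Rightarrow> bool) \<Rightarrow> literal \<Rightarrow> bool" where
  "sat_literal \<alpha> (b, v) \<longleftrightarrow> \<alpha> v = b"

fun sat_clause :: "(nat \<Rightarrow> bool) \<Rightarrow> clause \<Rightarrow> bool" where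
  "sat_clause \<alpha> (l\<^sub>1, l\<^sub>2, l\<^sub>3) \<longleftrightarrow> sat_literal \<alpha> l\<^sub>1 \<or> sat_literal \<alpha> l\<^sub>2 \<or> sat_literal \<alpha> l\<^sub>3"

definition satisfiable :: "formula \<Rightarrow> bool" where
  "satisfiable \<phi> \<longleftrightarrow> (\<exists>\<alpha>. \<forall>c \<in> set (snd \<phi>). sat_clause \<alpha> c)"

definition is_3cnf :: "formula \<Rightarrow> bool" where
  "is_3cnf \<phi> \<longleftrightarrow>
     (\<forall>(l\<^sub>1, l\<^sub>2, l\<^sub>3) \<in> set (snd \<phi>). snd l\<^sub>1 < fst \<phi> \<and> snd l\<^sub>2 < fst \<phi> \<and> snd l\<^sub>3 < fst \<phi>)"

fun enc_literal :: "literal \<Rightarrow> val" where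
  "enc_literal (b, v) = Pr (enc_bool b) (enc_nat v)"

fun enc_clause :: "clause \<Rightarrow> val" where
  "enc_clause (l\<^sub>1, l\<^sub>2, l\<^sub>3) = enc_list enc_literal [l\<^sub>1, l\<^sub>2, l\<^sub>3]"

definition enc_formula :: "formula \<Rightarrow> val" where
  "enc_formula \<phi> = Pr (enc_nat (fst \<phi>)) (enc_list enc_clause (snd \<phi>))"

definition sat3_inputs :: "(formula \<times> val) set" where
  "sat3_inputs = {(\<phi>, x). is_3cnf \<phi> \<and> x = enc_formula \<phi>}"

definition sat3_answer :: "formula \<Rightarrow> val \<Rightarrow> bool" where
  "sat3_answer \<phi> y \<longleftrightarrow> (y \<noteq> Nl \<longleftrightarrow> satisfiable \<phi>)"

definition num_vars :: "formula \<times> val \<Rightarrow> nat" where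
  "num_vars i = fst (fst i)"

definition num_clauses :: "formula \<times> val \<Rightarrow> nat" where
  "num_clauses i = length (snd (fst i))"

definition ETH :: bool where
  "ETH \<longleftrightarrow> \<not> (\<exists>f \<in> o(\<lambda>N::nat. real N).
     solvable_in_Ostar sat3_inputs sat3_answer {num_vars, num_clauses}
       (\<lambda>i. 2 powr f (num_vars i)))"

section \<open>The workflow satisfiability problem\<close>

text \<open>Functions \<open>L \<rightarrow> U\<close> are represented by the extensional functions
  \<^term>\<open>L \<rightarrow>\<^sub>E U\<close>.\<close>

type_synonym ('s, 'u) wsp_constraint = "'s set \<times> ('s \<Rightarrow> 'u) set"

record ('s, 'u) wsp =
  tasks :: "'s set"
  users :: "'u set"
  auth :: "'s \<Rightarrow> 'u set"
  constraints :: "('s, 'u) wsp_constraint set"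

definition wsp_instance :: "('s, 'u) wsp \<Rightarrow> bool" where
  "wsp_instance W \<longleftrightarrow> finite (tasks W) \<and> finite (users W) \<and>
     (\<forall>s \<in> tasks W. auth W s \<subseteq> users W) \<and>
     (\<forall>(L, \<Theta>) \<in> constraints W. L \<subseteq> tasks W \<and> \<Theta> \<subseteq> (L \<rightarrow>\<^sub>E users W))"

definition plan :: "('s, 'u) wsp \<Rightarrow> 's set \<Rightarrow> 'u set \<Rightarrow> ('s \<Rightarrow> 'u) \<Rightarrow> bool" where
  "plan W T X \<pi> \<longleftrightarrow> T \<subseteq> tasks W \<and> X \<subseteq> users W \<and> \<pi> \<in> T \<rightarrow>\<^sub>E X"

definition satisfies :: "'s set \<Rightarrow> ('s \<Rightarrow> 'u) \<Rightarrow> ('s, 'u) wsp_constraint \<Rightarrow> bool" where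
  "satisfies T \<pi> c \<longleftrightarrow> fst c - T \<noteq> {} \<or> restrict \<pi> (fst c) \<in> snd c"

definition eligible :: "('s, 'u) wsp \<Rightarrow> 's set \<Rightarrow> ('s \<Rightarrow> 'u) \<Rightarrow> bool" where
  "eligible W T \<pi> \<longleftrightarrow> (\<forall>c \<in> constraints W. satisfies T \<pi> c)"

definition authorized :: "('s, 'u) wsp \<Rightarrow> 's set \<Rightarrow> ('s \<Rightarrow> 'u) \<Rightarrow> bool" where
  "authorized W T \<pi> \<longleftrightarrow> (\<forall>s \<in> T. \<pi> s \<in> auth W s)"

definition valid :: "('s, 'u) wsp \<Rightarrow> 's set \<Rightarrow> ('s \<Rightarrow> 'u) \<Rightarrow> bool" where
  "valid W T \<pi> \<longleftrightarrow> eligible W T \<pi> \<and> authorized W T \<pi>"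

definition valid_complete_plan :: "('s, 'u) wsp \<Rightarrow> ('s \<Rightarrow> 'u) \<Rightarrow> bool" where
  "valid_complete_plan W \<pi> \<longleftrightarrow> plan W (tasks W) (users W) \<pi> \<and> valid W (tasks W) \<pi>"

definition user_independent :: "('s, 'u) wsp \<Rightarrow> ('s, 'u) wsp_constraint \<Rightarrow> bool" where
  "user_independent W c \<longleftrightarrow>
     (\<forall>\<theta> \<in> snd c. \<forall>\<psi>. \<psi> permutes users W \<longrightarrow> compose (fst c) \<psi> \<theta> \<in> snd c)"

text \<open>
  To be given to a program, the \<open>k\<close> tasks and \<open>n\<close> users are named \<open>0, \<dots>, k - 1\<close> and
  \<open>0, \<dots>, n - 1\<close>, and all sets are listed without repetitions, in any order. A constraint
  \<open>(L, \<Theta>)\<close> is presented by a list \<open>ls\<close> of its scope and the list of the value vectors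
  \<^term>\<open>map \<theta> ls\<close> of all \<open>\<theta> \<in> \<Theta>\<close>.
\<close>

definition lists_set :: "'a list \<Rightarrow> 'a set \<Rightarrow> bool" where
  "lists_set as A \<longleftrightarrow> distinct as \<and> set as = A"

fun encodes_constraint :: "(nat, nat) wsp_constraint \<Rightarrow> val \<Rightarrow> bool" where
  "encodes_constraint (L, \<Theta>) x \<longleftrightarrow>
     (\<exists>ls ts. lists_set ls L \<and> lists_set ts ((\<lambda>\<theta>. map \<theta> ls) ` \<Theta>) \<and>
        x = Pr (enc_list enc_nat ls) (enc_list (enc_list enc_nat) ts))"

definition encodes_wsp :: "(nat, nat) wsp \<Rightarrow> val \<Rightarrow> bool" where
  "encodes_wsp W x \<longleftrightarrow>
     (\<exists>k n as cs xs. tasks W = {..<k} \<and> users W = {..<n} \<and>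
        length as = k \<and> (\<forall>s<k. lists_set (as ! s) (auth W s)) \<and>
        lists_set cs (constraints W) \<and> list_all2 encodes_constraint cs xs \<and>
        x = enc_list (\<lambda>v. v)
              [enc_nat k, enc_nat n, enc_list (enc_list enc_nat) as, enc_list (\<lambda>v. v) xs])"

definition ui_wsp_inputs :: "((nat, nat) wsp \<times> val) set" where
  "ui_wsp_inputs =
     {(W, x). wsp_instance W \<and> (\<forall>c \<in> constraints W. user_independent W c) \<and> encodes_wsp W x}"

text \<open>The output \<^const>\<open>Nl\<close> means that there is no valid complete plan; otherwise such a plan
  has to be output, tagged so that the empty plan differs from \<^const>\<open>Nl\<close>.\<close>

definition wsp_answer :: "(nat, nat) wsp \<Rightarrow> val \<Rightarrow> bool" where
  "wsp_answer W y \<longleftrightarrow>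
     (if \<exists>\<pi>. valid_complete_plan W \<pi>
      then \<exists>\<pi>. valid_complete_plan W \<pi> \<and>
             y = Pr Nl (enc_list enc_nat (map \<pi> [0..<card (tasks W)]))
      else y = Nl)"

definition num_tasks :: "(nat, nat) wsp \<times> val \<Rightarrow> nat" where
  "num_tasks i = card (tasks (fst i))"

definition num_users :: "(nat, nat) wsp \<times> val \<Rightarrow> nat" where
  "num_users i = card (users (fst i))"

definition num_constraints :: "(nat, nat) wsp \<times> val \<Rightarrow> nat" where
  "num_constraints i = card (constraints (fst i))"

text \<open>The length of the input is not polynomially bounded in \<open>n\<close>, \<open>k\<close> and \<open>m\<close>, because a single
  constraint may contain up to \<open>n\<^sup>k\<close> functions. A lower bound that also allows a factor polynomial
  in the input length shows that hardness is not just due to the time needed to read the input.\<close>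

definition input_length :: "(nat, nat) wsp \<times> val \<Rightarrow> nat" where
  "input_length i = size (snd i)"

end

theory Submission
  imports Defs "HOL-Library.Discrete_Functions"
begin

text \<open>
  A 3-SAT instance with \<open>N\<close> variables is reduced in polynomial time to WSP with \<open>O(N / log N)\<close>
  tasks. Split the variables into groups of \<open>b \<approx> log N / 2\<close>, and let the \<open>n = 2^b\<close> users stand
  for the assignments of a group; there is a task \<open>x\<^sub>j\<close> for each group. User-independent constraints
  only see which tasks are performed by the same user, so for each user \<open>i\<close> there is an anchor task
  \<open>a\<^sub>i\<close> that only \<open>i\<close> may perform. That groups \<open>j\<^sub>1, j\<^sub>2, j\<^sub>3\<close> do not receive three assignments
  \<open>i\<^sub>1, i\<^sub>2, i\<^sub>3\<close> which falsify a clause is now user-independent: not all of \<open>x\<^bsub>j\<^sub>1\<^esub> = a\<^bsub>i\<^sub>1\<^esub>\<close>,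
  \<open>x\<^bsub>j\<^sub>2\<^esub> = a\<^bsub>i\<^sub>2\<^esub>\<close>, \<open>x\<^bsub>j\<^sub>3\<^esub> = a\<^bsub>i\<^sub>3\<^esub>\<close>. Its scope has bounded size, so it can be listed with fewer
  than \<open>n^6\<close> value vectors. Each task is taken in three copies, one for every position in a clause,
  so that the six tasks are always distinct; the copies are constrained to be equal. Since clauses
  of three literals meet at most three groups, no sparsification is needed.
\<close>

section \<open>Timed execution\<close>

definition halts_within :: "nat \<Rightarrow> com \<Rightarrow> state \<Rightarrow> (state \<Rightarrow> bool) \<Rightarrow> bool" where
  "halts_within t c s Q \<longleftrightarrow> (\<exists>u s'. exec c s u s' \<and> u \<le> t \<and> Q s')"

lemma halts_within_mono:
  "halts_within t c s Q \<Longrightarrow> t \<le> u \<Longrightarrow> (\<And>s'. Q s' \<Longrightarrow> R s') \<Longrightarrow> halts_within u c s R"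
  unfolding halts_within_def by (meson le_trans)

lemma halts_within_Assign:
  "Q (s(x := eval_expr e s)) \<Longrightarrow> 1 + cost e \<le> t \<Longrightarrow> halts_within t (Assign x e) s Q"
  unfolding halts_within_def using exec.Assign by blast

lemma halts_within_Seq:
  "halts_within t c s (\<lambda>s'. halts_within u d s' Q) \<Longrightarrow> halts_within (t + u) (Seq c d) s Q"
  unfolding halts_within_def by (meson exec.Seq add_mono)

lemma halts_within_If:
  assumes "eval_expr e s \<noteq> Nl \<Longrightarrow> halts_within t c s Q" "eval_expr e s = Nl \<Longrightarrow> halts_within t d s Q"
    and "1 + cost e \<le> u"
  shows "halts_within (u + t) (If e c d) s Q"
  using assms unfolding halts_within_def by (metis exec.IfTrue exec.IfFalse add_mono)

lemma halts_within_While_False: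
  "eval_expr e s = Nl \<Longrightarrow> Q s \<Longrightarrow> 1 + cost e \<le> t \<Longrightarrow> halts_within t (While e c) s Q"
  unfolding halts_within_def using exec.WhileFalse by blast

lemma halts_within_While_True:
  assumes "eval_expr e s \<noteq> Nl" "halts_within t c s (\<lambda>s'. halts_within u (While e c) s' Q)"
    "1 + cost e \<le> v"
  shows "halts_within (v + (t + u)) (While e c) s Q"
proof -
  obtain t' u' s' s'' where "exec c s t' s'" "t' \<le> t" "exec (While e c) s' u' s''" "u' \<le> u" "Q s''"
    using assms(2) by (auto simp: halts_within_def)
  with exec.WhileTrue[OF assms(1) this(1,3)] assms(3) show ?thesis
    unfolding halts_within_def by (intro exI[of _ "1 + cost e + t' + u'"]) auto
qed

fun assigned :: "com \<Rightarrow> nat set" where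
  "assigned Skip = {}"
| "assigned (Assign x e) = {x}"
| "assigned (Seq c d) = assigned c \<union> assigned d"
| "assigned (If e c d) = assigned c \<union> assigned d"
| "assigned (While e c) = assigned c"

lemma finite_assigned: "finite (assigned c)"
  by (induction c) auto

lemma exec_not_assigned: "exec c s t s' \<Longrightarrow> x \<notin> assigned c \<Longrightarrow> s' x = s x"
  by (induction rule: exec.induct) auto

fun clear :: "nat list \<Rightarrow> com" where
  "clear [] = Skip"
| "clear (x # xs) = Seq (Assign x NlE) (clear xs)"

lemma exec_clear: "exec (clear xs) s (1 + 2 * length xs) (\<lambda>x. if x \<in> set xs then Nl else s x)"
proof (induction xs arbitrary: s)
  case Nil
  then show ?case using exec.Skip by simp
next
  case (Cons x xs)
  have "exec (clear (x # xs)) s (1 + 1 + (1 + 2 * length xs))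
      (\<lambda>y. if y \<in> set xs then Nl else (s(x := Nl)) y)"
    using exec.Seq[OF exec.Assign[of x NlE s] Cons.IH]
    by (simp only: eval_expr.simps cost.simps clear.simps)
  moreover have "(\<lambda>y. if y \<in> set xs then Nl else (s(x := Nl)) y) =
      (\<lambda>y. if y \<in> set (x # xs) then Nl else s y)"
    by auto
  ultimately show ?case by simp
qed

section \<open>Polynomial-time functions\<close>

inductive nat_polynomial :: "(nat \<Rightarrow> nat) \<Rightarrow> bool" where
  const: "nat_polynomial (\<lambda>_. c)"
| id: "nat_polynomial (\<lambda>n. n)"
| add: "nat_polynomial p \<Longrightarrow> nat_polynomial q \<Longrightarrow> nat_polynomial (\<lambda>n. p n + q n)"
| mult: "nat_polynomial p \<Longrightarrow> nat_polynomial q \<Longrightarrow> nat_polynomial (\<lambda>n. p n * q n)"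

lemma nat_polynomial_mono: "nat_polynomial p \<Longrightarrow> m \<le> n \<Longrightarrow> p m \<le> p n"
  by (induction rule: nat_polynomial.induct) (auto intro: add_mono mult_mono)

lemma nat_polynomial_compose:
  "nat_polynomial p \<Longrightarrow> nat_polynomial q \<Longrightarrow> nat_polynomial (\<lambda>n. p (q n))"
  by (induction rule: nat_polynomial.induct) (auto intro: nat_polynomial.intros)

lemma nat_polynomial_Suc: "nat_polynomial p \<Longrightarrow> nat_polynomial (\<lambda>n. Suc (p n))"
  using nat_polynomial.add[OF nat_polynomial.const[of 1]] by simp

lemmas nat_polynomial_intros = nat_polynomial.intros nat_polynomial_Suc

text \<open>The registers below the output register are preserved and those above it are scratch space
  with arbitrary initial contents, so that programs compose. The size of the output is bounded
  separately because sharing lets trees grow exponentially in time.\<close>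

abbreviation returns :: "nat \<Rightarrow> val \<Rightarrow> state \<Rightarrow> state \<Rightarrow> bool" where
  "returns d v s s' \<equiv> s' d = v \<and> (\<forall>i<d. s' i = s i)"

definition computes ::
  "('a \<Rightarrow> val) \<Rightarrow> ('b \<Rightarrow> val) \<Rightarrow> ('a \<Rightarrow> 'b) \<Rightarrow> (nat \<Rightarrow> nat) \<Rightarrow> nat \<Rightarrow> nat \<Rightarrow> com \<Rightarrow> bool"
where
  "computes A B f p m d P \<longleftrightarrow>
     (\<forall>s x. s m = A x \<longrightarrow> halts_within (p (size (A x))) P s (returns d (B (f x)) s))"

definition polytime :: "('a \<Rightarrow> val) \<Rightarrow> ('b \<Rightarrow> val) \<Rightarrow> ('a \<Rightarrow> 'b) \<Rightarrow> bool" where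
  "polytime A B f \<longleftrightarrow> (\<exists>p. nat_polynomial p \<and> (\<forall>x. size (B (f x)) \<le> p (size (A x))) \<and>
     (\<forall>m d. m \<le> d \<longrightarrow> (\<exists>P. computes A B f p m d P)))"

lemma halts_within_computes:
  assumes "computes A B f p m d P" "s m = A x" "p (size (A x)) \<le> t"
    and "\<And>s'. s' d = B (f x) \<Longrightarrow> (\<And>i. i < d \<Longrightarrow> s' i = s i) \<Longrightarrow> Q s'"
  shows "halts_within t P s Q"
  using assms halts_within_mono unfolding computes_def by blast

lemma polytimeI:
  assumes "nat_polynomial p" "nat_polynomial q" "\<And>x. size (B (f x)) \<le> q (size (A x))"
    and halts: "\<And>m d s x. m \<le> d \<Longrightarrow> s m = A x \<Longrightarrow>
      halts_within (p (size (A x))) (P m d) s (returns d (B (f x)) s)"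
  shows "polytime A B f"
proof -
  have "computes A B f (\<lambda>n. p n + q n) m d (P m d)" if "m \<le> d" for m d
    unfolding computes_def using halts_within_mono[OF halts[OF that]] by simp
  moreover have "size (B (f x)) \<le> p (size (A x)) + q (size (A x))" for x
    using assms(3)[of x] by simp
  ultimately show ?thesis
    unfolding polytime_def using nat_polynomial.add[OF assms(1,2)] by blast
qed

lemma polytimeE:
  assumes "polytime A B f"
  obtains p P where "nat_polynomial p" "\<And>x. size (B (f x)) \<le> p (size (A x))"
    "\<And>m d. m \<le> d \<Longrightarrow> computes A B f p m d (P m d)"
  using assms unfolding polytime_def by metis

lemma polytime_recode:
  assumes "polytime A B f" "\<And>x. B' (f' x) = B (f x)"
  shows "polytime A B' f'"
  using assms(1) unfolding polytime_def computes_def assms(2) .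

lemma polytime_eval_expr:
  assumes eval: "\<And>m s x. s m = A x \<Longrightarrow> eval_expr (e m) s = B (f x)" and cost: "\<And>m. cost (e m) \<le> c"
    and poly_q: "nat_polynomial q" and size_f: "\<And>x. size (B (f x)) \<le> q (size (A x))"
  shows "polytime A B f"
proof (rule polytimeI)
  show "halts_within (1 + c) (Assign d (e m)) s (returns d (B (f x)) s)"
    if "s m = A x" for m d :: nat and s :: state and x
    using that by (intro halts_within_Assign) (simp_all add: eval cost)
qed (auto intro: nat_polynomial_intros poly_q size_f)

lemma polytime_compose:
  assumes "polytime B C g" "polytime A B f"
  shows "polytime A C (\<lambda>x. g (f x))"
proof -
  obtain p P where poly_p: "nat_polynomial p" and size_g: "\<And>y. size (C (g y)) \<le> p (size (B y))"
    and P: "\<And>m d. m \<le> d \<Longrightarrow> computes B C g p m d (P m d)"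
    using assms(1) by (rule polytimeE) blast
  obtain q Q where poly_q: "nat_polynomial q" and size_f: "\<And>x. size (B (f x)) \<le> q (size (A x))"
    and Q: "\<And>m d. m \<le> d \<Longrightarrow> computes A B f q m d (Q m d)"
    using assms(2) by (rule polytimeE) blast
  have p_le: "p (size (B (f x))) \<le> p (q (size (A x)))" for x
    using poly_p size_f by (rule nat_polynomial_mono)
  show ?thesis
  proof (rule polytimeI)
    fix m d :: nat and s :: state and x
    assume m_le: "m \<le> d" and s_m: "s m = A x"
    show "halts_within (q (size (A x)) + p (q (size (A x)))) (Seq (Q m d) (P d d)) s
        (returns d (C (g (f x))) s)"
      using p_le s_m by (intro halts_within_Seq halts_within_computes[OF Q[OF m_le]]
          halts_within_computes[OF P[OF order_refl]]) auto
  next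
    show "size (C (g (f x))) \<le> p (q (size (A x)))" for x
      using size_g p_le by (rule le_trans)
  qed (intro nat_polynomial_intros nat_polynomial_compose[OF poly_p] poly_p poly_q)+
qed

named_theorems polytime_intros

lemma polytime_id [polytime_intros]: "polytime A A (\<lambda>x. x)"
  by (rule polytime_eval_expr[where e = Var and c = 1]) (auto intro: nat_polynomial_intros)

definition enc_pair :: "('a \<Rightarrow> val) \<Rightarrow> ('b \<Rightarrow> val) \<Rightarrow> 'a \<times> 'b \<Rightarrow> val" where
  "enc_pair A B p = Pr (A (fst p)) (B (snd p))"

lemma polytime_hd_val: "(\<And>x. hd_val (A x) = B (f x)) \<Longrightarrow> polytime A B f"
proof (rule polytime_eval_expr[where e = "\<lambda>m. Hd (Var m)" and c = 2])
  show "size (B (f x)) \<le> size (A x)" if "\<And>x. hd_val (A x) = B (f x)" for x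
    using that[of x, symmetric] by (cases "A x") auto
qed (auto intro: nat_polynomial_intros)

lemma polytime_tl_val: "(\<And>x. tl_val (A x) = B (f x)) \<Longrightarrow> polytime A B f"
proof (rule polytime_eval_expr[where e = "\<lambda>m. Tl (Var m)" and c = 2])
  show "size (B (f x)) \<le> size (A x)" if "\<And>x. tl_val (A x) = B (f x)" for x
    using that[of x, symmetric] by (cases "A x") auto
qed (auto intro: nat_polynomial_intros)

lemma polytime_fst [polytime_intros]:
  "polytime E (enc_pair A B) f \<Longrightarrow> polytime E A (\<lambda>x. fst (f x))"
  by (rule polytime_compose[OF polytime_hd_val]) (simp_all add: enc_pair_def)

lemma polytime_snd [polytime_intros]:
  "polytime E (enc_pair A B) f \<Longrightarrow> polytime E B (\<lambda>x. snd (f x))"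
  by (rule polytime_compose[OF polytime_tl_val]) (simp_all add: enc_pair_def)

lemma polytime_Pr:
  assumes "polytime E A f" "polytime E B g" and Pr: "\<And>x. C (h x) = Pr (A (f x)) (B (g x))"
  shows "polytime E C h"
proof -
  obtain p P where poly_p: "nat_polynomial p" and size_f: "\<And>x. size (A (f x)) \<le> p (size (E x))"
    and P: "\<And>m d. m \<le> d \<Longrightarrow> computes E A f p m d (P m d)"
    using assms(1) by (rule polytimeE) blast
  obtain q Q where poly_q: "nat_polynomial q" and size_g: "\<And>x. size (B (g x)) \<le> q (size (E x))"
    and Q: "\<And>m d. m \<le> d \<Longrightarrow> computes E B g q m d (Q m d)"
    using assms(2) by (rule polytimeE) blast
  show ?thesis
  proof (rule polytimeI)
    fix m d :: nat and s :: state and x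
    assume m_le: "m \<le> d" and s_m: "s m = E x"
    show "halts_within (p (size (E x)) + (q (size (E x)) + 4))
        (Seq (P m (d+1)) (Seq (Q m (d+2)) (Assign d (PrE (Var (d+1)) (Var (d+2)))))) s
        (returns d (C (h x)) s)"
      using m_le s_m by (intro halts_within_Seq halts_within_computes[OF P[of m "d+1"]]
          halts_within_computes[OF Q[of m "d+2"]] halts_within_Assign) (auto simp: Pr)
  next
    show "size (C (h x)) \<le> Suc (p (size (E x)) + q (size (E x)))" for x
      using size_f[of x] size_g[of x] by (simp add: Pr)
  qed (auto intro!: nat_polynomial_intros poly_p poly_q)
qed

lemma polytime_Pair [polytime_intros]:
  "polytime E A f \<Longrightarrow> polytime E B g \<Longrightarrow> polytime E (enc_pair A B) (\<lambda>x. (f x, g x))"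
  by (rule polytime_Pr[of E A f B g]) (simp_all add: enc_pair_def)

lemma polytime_Nl: "(\<And>x. B (f x) = Nl) \<Longrightarrow> polytime E B f"
  by (rule polytime_eval_expr[where e = "\<lambda>_. NlE" and c = 1 and q = "\<lambda>_. 0"])
    (auto intro: nat_polynomial_intros)

lemma polytime_const [polytime_intros]: "polytime E B (\<lambda>_. c)"
proof -
  have "polytime E (\<lambda>v. v) (\<lambda>_. v)" for v
    by (induction v)
      (rule polytime_Nl polytime_Pr[where f = "\<lambda>_. x" and g = "\<lambda>_. y" for x y]; simp)+
  then show ?thesis by (rule polytime_recode) simp
qed

lemma polytime_If_Nl:
  assumes "polytime E A c" "polytime E B f" "polytime E B g"
  shows "polytime E B (\<lambda>x. if A (c x) = Nl then f x else g x)"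
proof -
  obtain p P where poly_p: "nat_polynomial p"
    and P: "\<And>m d. m \<le> d \<Longrightarrow> computes E A c p m d (P m d)"
    using assms(1) by (rule polytimeE) blast
  obtain q Q where poly_q: "nat_polynomial q" and size_f: "\<And>x. size (B (f x)) \<le> q (size (E x))"
    and Q: "\<And>m d. m \<le> d \<Longrightarrow> computes E B f q m d (Q m d)"
    using assms(2) by (rule polytimeE) blast
  obtain r R where poly_r: "nat_polynomial r" and size_g: "\<And>x. size (B (g x)) \<le> r (size (E x))"
    and R: "\<And>m d. m \<le> d \<Longrightarrow> computes E B g r m d (R m d)"
    using assms(3) by (rule polytimeE) blast
  show ?thesis
  proof (rule polytimeI)
    fix m d :: nat and s :: state and x
    assume m_le: "m \<le> d" and s_m: "s m = E x"
    show "halts_within (p (size (E x)) + (2 + (q (size (E x)) + r (size (E x)))))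
        (Seq (P m (d+1)) (If (Var (d+1)) (R m d) (Q m d))) s
        (returns d (B (if A (c x) = Nl then f x else g x)) s)"
      using m_le s_m
      by (intro halts_within_Seq halts_within_computes[OF P[of m "d+1"]] halts_within_If
          halts_within_computes[OF Q[OF m_le]] halts_within_computes[OF R[OF m_le]]) auto
  next
    show "size (B (if A (c x) = Nl then f x else g x)) \<le> q (size (E x)) + r (size (E x))" for x
      using size_f[of x] size_g[of x] by simp
  qed (auto intro!: nat_polynomial_intros poly_p poly_q poly_r)
qed

section \<open>Folding over lists\<close>

lemma size_enc_list_member: "y \<in> set ys \<Longrightarrow> size (A y) \<le> size (enc_list A ys)"
  by (induction ys) auto

lemma length_le_size_enc_list: "length ys \<le> size (enc_list A ys)"
  by (induction ys) auto

definition fold_loop :: "nat \<Rightarrow> nat \<Rightarrow> com \<Rightarrow> com" where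
  "fold_loop m d F = While (Var (d+1))
     (Seq (Assign (d+3) (PrE (Var m) (PrE (Hd (Var (d+1))) (Var (d+2)))))
     (Seq F
     (Seq (Assign (d+2) (Var (d+3)))
          (Assign (d+1) (Tl (Var (d+1)))))))"

abbreviation computes_step ::
  "('a \<Rightarrow> val) \<Rightarrow> ('b \<Rightarrow> val) \<Rightarrow> ('c \<Rightarrow> val) \<Rightarrow> ('a \<Rightarrow> 'b \<Rightarrow> 'c \<Rightarrow> 'c) \<Rightarrow>
    (nat \<Rightarrow> nat) \<Rightarrow> nat \<Rightarrow> com \<Rightarrow> bool"
where
  "computes_step E A B f p d F \<equiv> computes (enc_pair E (enc_pair A B)) B
     (\<lambda>z. f (fst z) (fst (snd z)) (snd (snd z))) p (d+3) (d+3) F"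

lemma halts_within_fold_loop:
  assumes F: "computes_step E A B f p d F"
    and step_time: "\<And>k y. y \<in> set ys \<Longrightarrow>
      p (size (enc_pair E (enc_pair A B) (x, y, fold (f x) (take k ys) b))) \<le> T"
    and "m \<le> d" "s m = E x" "s (d+1) = enc_list A ys" "s (d+2) = B b"
  shows "halts_within (2 + length ys * (T + 14)) (fold_loop m d F) s
    (\<lambda>s'. s' (d+2) = B (fold (f x) ys b) \<and> (\<forall>i\<le>d. s' i = s i))"
  using step_time assms(4-)
proof (induction ys arbitrary: s b)
  case Nil
  then show ?case
    unfolding fold_loop_def by (intro halts_within_While_False) auto
next
  case (Cons y ys)
  have rest: "halts_within (2 + length ys * (T + 14)) (fold_loop m d F) s'
      (\<lambda>s''. s'' (d+2) = B (fold (f x) (y # ys) b) \<and> (\<forall>i\<le>d. s'' i = s i))"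
    if "\<And>i. i \<le> d \<Longrightarrow> s' i = s i" "s' (d+1) = enc_list A ys" "s' (d+2) = B (f x y b)" for s'
  proof (rule halts_within_mono[OF Cons.IH[of "f x y b" s'] order_refl])
    show "p (size (enc_pair E (enc_pair A B) (x, z, fold (f x) (take k ys) (f x y b)))) \<le> T"
      if "z \<in> set ys" for k z
      using Cons.prems(1)[of z "Suc k"] that by simp
  qed (use Cons.prems(2) \<open>m \<le> d\<close> that in auto)
  have "p (size (enc_pair E (enc_pair A B) (x, y, b))) \<le> T"
    using Cons.prems(1)[of y 0] by simp
  then have "halts_within (2 + ((7 + (T + (2 + 3))) + (2 + length ys * (T + 14))))
    (fold_loop m d F) s (\<lambda>s'. s' (d+2) = B (fold (f x) (y # ys) b) \<and> (\<forall>i\<le>d. s' i = s i))"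
    unfolding fold_loop_def
    using Cons.prems(2-) \<open>m \<le> d\<close>
    by (intro halts_within_While_True halts_within_Seq halts_within_Assign
        halts_within_computes[OF F, of _ "(x, y, b)"] rest[unfolded fold_loop_def])
      (auto simp: enc_pair_def)
  then show ?case by (simp add: algebra_simps)
qed

lemma halts_within_fold:
  assumes F: "computes_step E A B f pf d F"
    and L: "computes E (enc_list A) l pl m (d+1) L" and I: "computes E B a pa m (d+2) I"
    and step_time: "\<And>k y. y \<in> set (l x) \<Longrightarrow>
      pf (size (enc_pair E (enc_pair A B) (x, y, fold (f x) (take k (l x)) (a x)))) \<le> T"
    and m_le: "m \<le> d" and s_m: "s m = E x" and length_le: "length (l x) \<le> n"
  shows "halts_within (pl (size (E x)) + (pa (size (E x)) + (2 + n * (T + 14) + 2)))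
    (Seq L (Seq I (Seq (fold_loop m d F) (Assign d (Var (d+2)))))) s
    (returns d (B (fold (f x) (l x) (a x))) s)"
proof -
  have loop: "halts_within (2 + length (l x) * (T + 14)) (fold_loop m d F) s'
      (\<lambda>s''. s'' (d+2) = B (fold (f x) (l x) (a x)) \<and> (\<forall>i\<le>d. s'' i = s' i))"
    if "s' (d+1) = enc_list A (l x)" "s' (d+2) = B (a x)" "s' m = E x" for s'
    using step_time that m_le by (intro halts_within_fold_loop[OF F]) auto
  have "length (l x) * (T + 14) \<le> n * (T + 14)" using length_le by (rule mult_le_mono1)
  then show ?thesis
    using m_le s_m by (intro halts_within_Seq halts_within_computes[OF L]
        halts_within_computes[OF I] halts_within_mono[OF loop] halts_within_Assign) auto
qed

lemma polytime_fold_bounded: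
  assumes "polytime (enc_pair E (enc_pair A B)) B (\<lambda>z. f (fst z) (fst (snd z)) (snd (snd z)))"
    and "polytime E (enc_list A) l" "polytime E B a"
    and poly_M: "nat_polynomial M"
    and size_fold: "\<And>x k. size (B (fold (f x) (take k (l x)) (a x))) \<le> M (size (E x))"
  shows "polytime E B (\<lambda>x. fold (f x) (l x) (a x))"
proof -
  obtain pf F where poly_pf: "nat_polynomial pf"
    and F: "\<And>d. computes_step E A B f pf d (F (d+3) (d+3))"
    using assms(1) by (rule polytimeE) blast
  obtain pl L where poly_pl: "nat_polynomial pl"
    and size_l: "\<And>x. size (enc_list A (l x)) \<le> pl (size (E x))"
    and L: "\<And>m d. m \<le> d \<Longrightarrow> computes E (enc_list A) l pl m d (L m d)"
    using assms(2) by (rule polytimeE) blast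
  obtain pa I where poly_pa: "nat_polynomial pa"
    and I: "\<And>m d. m \<le> d \<Longrightarrow> computes E B a pa m d (I m d)"
    using assms(3) by (rule polytimeE) blast
  define T where "T n = pf (n + (pl n + M n) + 2)" for n
  have poly_T: "nat_polynomial T"
    unfolding T_def
    by (intro nat_polynomial_intros nat_polynomial_compose[OF poly_pf] poly_pl poly_M)
  have step_time:
    "pf (size (enc_pair E (enc_pair A B) (x, y, fold (f x) (take k (l x)) (a x)))) \<le> T (size (E x))"
    if "y \<in> set (l x)" for x y k
    unfolding T_def enc_pair_def
    using size_enc_list_member[OF that, of A] size_l[of x] size_fold[where x = x and k = k]
    by (intro nat_polynomial_mono[OF poly_pf]) simp
  show ?thesis
  proof (rule polytimeI)
    fix m d :: nat and s :: state and x
    assume m_le: "m \<le> d" and s_m: "s m = E x"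
    let ?n = "size (E x)"
    have "length (l x) \<le> pl ?n"
      using length_le_size_enc_list size_l by (rule le_trans)
    then show "halts_within (pl ?n + (pa ?n + (2 + pl ?n * (T ?n + 14) + 2)))
        (Seq (L m (d+1)) (Seq (I m (d+2))
          (Seq (fold_loop m d (F (d+3) (d+3))) (Assign d (Var (d+2)))))) s
        (returns d (B (fold (f x) (l x) (a x))) s)"
      using m_le s_m step_time[of _ x] by (intro halts_within_fold[OF F L I]) auto
  next
    show "size (B (fold (f x) (l x) (a x))) \<le> M (size (E x))" for x
      using size_fold[where x = x and k = "length (l x)"] by simp
  qed (intro nat_polynomial_intros poly_M poly_T poly_pl poly_pa)+
qed

lemma size_fold_le:
  assumes "nat_polynomial q" "\<And>y b. size (B (f y b)) \<le> size (B b) + q (e + size (A y))"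
    and "\<And>y. y \<in> set ys \<Longrightarrow> size (A y) \<le> L"
  shows "size (B (fold f ys b)) \<le> size (B b) + length ys * q (e + L)"
  using assms(3)
proof (induction ys arbitrary: b)
  case (Cons y ys)
  have "q (e + size (A y)) \<le> q (e + L)"
    using Cons.prems by (intro nat_polynomial_mono[OF assms(1)]) simp
  with Cons.IH[of "f y b"] Cons.prems assms(2)[of y b] show ?case by simp
qed simp

lemma polytime_fold:
  assumes f: "polytime (enc_pair E (enc_pair A B)) B (\<lambda>z. f (fst z) (fst (snd z)) (snd (snd z)))"
    and l: "polytime E (enc_list A) l" and a: "polytime E B a" and poly_q: "nat_polynomial q"
    and growth: "\<And>x y b. size (B (f x y b)) \<le> size (B b) + q (size (E x) + size (A y))"
  shows "polytime E B (\<lambda>x. fold (f x) (l x) (a x))"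
proof -
  obtain pl where poly_pl: "nat_polynomial pl"
    and size_l: "\<And>x. size (enc_list A (l x)) \<le> pl (size (E x))"
    using l by (rule polytimeE) blast
  obtain pa where poly_pa: "nat_polynomial pa" and size_a: "\<And>x. size (B (a x)) \<le> pa (size (E x))"
    using a by (rule polytimeE) blast
  show ?thesis
  proof (rule polytime_fold_bounded[OF f l a])
    fix x k
    let ?n = "size (E x)"
    have "size (A y) \<le> pl ?n" if "y \<in> set (take k (l x))" for y
      using size_enc_list_member[of y "l x" A] in_set_takeD[OF that] size_l[of x] by simp
    then have "size (B (fold (f x) (take k (l x)) (a x)))
        \<le> size (B (a x)) + length (take k (l x)) * q (?n + pl ?n)"
      by (rule size_fold_le[where A = A, OF poly_q growth])
    also have "\<dots> \<le> pa ?n + pl ?n * q (?n + pl ?n)"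
      using size_a[of x] length_le_size_enc_list[of "l x" A] size_l[of x]
      by (intro add_mono mult_le_mono) auto
    finally show "size (B (fold (f x) (take k (l x)) (a x))) \<le> pa ?n + pl ?n * q (?n + pl ?n)" .
  qed (intro nat_polynomial_intros nat_polynomial_compose[OF poly_q] poly_pl poly_pa)
qed

section \<open>Polynomial-time list functions\<close>

lemma polytime_compose2:
  assumes "polytime (enc_pair A B) C (\<lambda>z. f (fst z) (snd z))" "polytime E A g" "polytime E B h"
  shows "polytime E C (\<lambda>x. f (g x) (h x))"
  using polytime_compose[OF assms(1) polytime_Pair[OF assms(2,3)]] by simp

lemma polytime_Nil_iff [polytime_intros]:
  "polytime E (enc_list A) l \<Longrightarrow> polytime E enc_bool (\<lambda>x. l x = [])"
proof (erule polytime_recode[OF polytime_If_Nl[OF _ polytime_const polytime_const]])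
  show "enc_bool (l x = []) = (if enc_list A (l x) = Nl then Pr Nl Nl else Nl)" for x
    by (cases "l x") (simp_all add: enc_bool_def)
qed

lemma polytime_If [polytime_intros]:
  assumes "polytime E enc_bool c" "polytime E B f" "polytime E B g"
  shows "polytime E B (\<lambda>x. if c x then f x else g x)"
  by (rule polytime_recode[OF polytime_If_Nl[OF assms(1,3,2)]]) (simp add: enc_bool_def)

lemma polytime_Cons [polytime_intros]:
  "polytime E A f \<Longrightarrow> polytime E (enc_list A) l \<Longrightarrow> polytime E (enc_list A) (\<lambda>x. f x # l x)"
  by (rule polytime_Pr[of E A f "enc_list A" l]) simp_all

lemma polytime_rev [polytime_intros]:
  "polytime E (enc_list A) l \<Longrightarrow> polytime E (enc_list A) (\<lambda>x. rev (l x))"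
  unfolding rev_conv_fold
  by (rule polytime_fold[where q = Suc])
    (rule polytime_intros nat_polynomial_intros | assumption | simp)+

lemma polytime_append [polytime_intros]:
  assumes "polytime E (enc_list A) l" "polytime E (enc_list A) l'"
  shows "polytime E (enc_list A) (\<lambda>x. l x @ l' x)"
proof -
  have "polytime E (enc_list A) (\<lambda>x. fold Cons (rev (l x)) (l' x))"
    by (rule polytime_fold[where q = Suc])
      (rule polytime_intros nat_polynomial_intros assms | simp)+
  then show ?thesis by (simp add: fold_Cons_rev)
qed

lemma size_enc_list_append:
  "size (enc_list A (xs @ ys)) = size (enc_list A xs) + size (enc_list A ys)"
  by (induction xs) auto

lemma polytime_concat [polytime_intros]:
  assumes "polytime E (enc_list (enc_list A)) l"
  shows "polytime E (enc_list A) (\<lambda>x. concat (l x))"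
  unfolding concat_conv_foldr foldr_conv_fold
  by (rule polytime_fold[where q = "\<lambda>n. n"])
    (rule polytime_intros nat_polynomial_intros assms | simp add: size_enc_list_append)+

lemma polytime_map [polytime_intros]:
  assumes "polytime E (enc_list A) l" "polytime (enc_pair E A) B (\<lambda>z. f (fst z) (snd z))"
  shows "polytime E (enc_list B) (\<lambda>x. map (f x) (l x))"
proof -
  obtain p where poly_p: "nat_polynomial p"
    and size_f: "\<And>z. size (B (f (fst z) (snd z))) \<le> p (size (enc_pair E A z))"
    using assms(2) by (rule polytimeE) blast
  have step: "polytime (enc_pair E (enc_pair A (enc_list B))) B (\<lambda>z. f (fst z) (fst (snd z)))"
    by (rule polytime_compose2[OF assms(2)] polytime_intros)+
  have "polytime E (enc_list B) (\<lambda>x. fold (\<lambda>y. Cons (f x y)) (rev (l x)) [])"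
  proof (rule polytime_fold[where q = "\<lambda>n. Suc (p (Suc n))"])
    show "size (enc_list B (f x y # b))
        \<le> size (enc_list B b) + Suc (p (Suc (size (E x) + size (A y))))" for x y b
      using size_f[of "(x, y)"] by (simp add: enc_pair_def)
  qed (rule step polytime_intros nat_polynomial_intros nat_polynomial_compose[OF poly_p] assms)+
  moreover have "foldr (\<lambda>y. Cons (f x y)) ys [] = map (f x) ys" for x ys
    by (induction ys) auto
  ultimately show ?thesis by (simp add: foldr_conv_fold)
qed

lemma polytime_filter [polytime_intros]:
  assumes "polytime E (enc_list A) l" "polytime (enc_pair E A) enc_bool (\<lambda>z. P (fst z) (snd z))"
  shows "polytime E (enc_list A) (\<lambda>x. filter (P x) (l x))"
proof -
  have "filter (P x) ys = concat (map (\<lambda>y. if P x y then [y] else []) ys)" for x ys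
    by (induction ys) auto
  then show ?thesis by (simp only:) (rule polytime_intros assms)+
qed

lemma polytime_product [polytime_intros]:
  assumes "polytime E (enc_list A) l" "polytime E (enc_list B) l'"
  shows "polytime E (enc_list (enc_pair A B)) (\<lambda>x. List.product (l x) (l' x))"
  unfolding product_concat_map
  by (rule polytime_intros assms assms[THEN polytime_compose])+

lemma polytime_Not [polytime_intros]:
  assumes "polytime E enc_bool P"
  shows "polytime E enc_bool (\<lambda>x. \<not> P x)"
proof -
  have "polytime E enc_bool (\<lambda>x. if P x then False else True)" by (rule polytime_intros assms)+
  then show ?thesis by (rule polytime_recode) simp
qed

lemma polytime_conj [polytime_intros]:
  assumes "polytime E enc_bool P" "polytime E enc_bool Q"
  shows "polytime E enc_bool (\<lambda>x. P x \<and> Q x)"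
proof -
  have "polytime E enc_bool (\<lambda>x. if P x then Q x else False)" by (rule polytime_intros assms)+
  then show ?thesis by (rule polytime_recode) simp
qed

lemma polytime_bool_eq [polytime_intros]:
  assumes "polytime E enc_bool P" "polytime E enc_bool Q"
  shows "polytime E enc_bool (\<lambda>x. P x = Q x)"
proof -
  have "polytime E enc_bool (\<lambda>x. if P x then Q x else \<not> Q x)" by (rule polytime_intros assms)+
  then show ?thesis by (rule polytime_recode) auto
qed

lemma polytime_bex_set [polytime_intros]:
  assumes "polytime E (enc_list A) l" "polytime (enc_pair E A) enc_bool (\<lambda>z. P (fst z) (snd z))"
  shows "polytime E enc_bool (\<lambda>x. \<exists>y \<in> set (l x). P x y)"
proof -
  have "polytime E enc_bool (\<lambda>x. filter (P x) (l x) \<noteq> [])" by (rule polytime_intros assms)+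
  then show ?thesis by (simp add: filter_empty_conv)
qed

section \<open>Polynomial-time arithmetic in unary notation\<close>

abbreviation enc_unit :: "unit \<Rightarrow> val" where
  "enc_unit \<equiv> \<lambda>_. Nl"

lemma enc_list_const_cong:
  "length xs = length ys \<Longrightarrow> enc_list (\<lambda>_. c) xs = enc_list (\<lambda>_. c) ys"
  by (induction xs ys rule: list_induct2) simp_all

lemma enc_nat_eq_replicate: "enc_nat n = enc_list enc_unit (replicate n ())"
  unfolding enc_nat_def by (rule enc_list_const_cong) simp

lemma size_enc_nat: "size (enc_nat n) = n"
  by (induction n) (simp_all add: enc_nat_eq_replicate)

lemma polytime_length [polytime_intros]:
  assumes "polytime E (enc_list A) l"
  shows "polytime E enc_nat (\<lambda>x. length (l x))"
proof -
  have "polytime E (enc_list enc_unit) (\<lambda>x. map (\<lambda>_. ()) (l x))" by (rule polytime_intros assms)+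
  then show ?thesis by (rule polytime_recode) (simp add: enc_nat_eq_replicate map_replicate_const)
qed

lemma polytime_replicate [polytime_intros]:
  assumes "polytime E enc_nat n" "polytime E A f"
  shows "polytime E (enc_list A) (\<lambda>x. replicate (n x) (f x))"
proof -
  have units: "polytime E (enc_list enc_unit) (\<lambda>x. replicate (n x) ())"
    using assms(1) by (rule polytime_recode) (simp add: enc_nat_eq_replicate)
  have "polytime E (enc_list A) (\<lambda>x. map (\<lambda>_. f x) (replicate (n x) ()))"
    by (rule units polytime_intros assms(2)[THEN polytime_compose])+
  then show ?thesis by simp
qed

lemma polytime_add [polytime_intros]:
  assumes "polytime E enc_nat a" "polytime E enc_nat b"
  shows "polytime E enc_nat (\<lambda>x. a x + b x)"
proof -
  have "polytime E enc_nat (\<lambda>x. length (replicate (a x) () @ replicate (b x) ()))"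
    by (rule polytime_intros assms)+
  then show ?thesis by simp
qed

lemma polytime_Suc [polytime_intros]:
  "polytime E enc_nat a \<Longrightarrow> polytime E enc_nat (\<lambda>x. Suc (a x))"
  using polytime_add[OF _ polytime_const[of E enc_nat 1]] by simp

lemma polytime_mult [polytime_intros]:
  assumes "polytime E enc_nat a" "polytime E enc_nat b"
  shows "polytime E enc_nat (\<lambda>x. a x * b x)"
proof -
  have "polytime E enc_nat (\<lambda>x. length (List.product (replicate (a x) ()) (replicate (b x) ())))"
    by (rule polytime_intros assms)+
  then show ?thesis by simp
qed

lemma polytime_pred: "polytime enc_nat enc_nat (\<lambda>n. n - 1)"
proof (rule polytime_tl_val)
  show "tl_val (enc_nat n) = enc_nat (n - 1)" for n
    by (cases n) (simp_all add: enc_nat_eq_replicate)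
qed

lemma polytime_diff [polytime_intros]:
  assumes "polytime E enc_nat a" "polytime E enc_nat b"
  shows "polytime E enc_nat (\<lambda>x. a x - b x)"
proof -
  have "polytime E enc_nat (\<lambda>x. fold (\<lambda>_ n. n - 1) (replicate (b x) ()) (a x))"
    by (rule polytime_fold[where q = "\<lambda>_. 0"])
      (rule polytime_intros nat_polynomial_intros assms polytime_compose[OF polytime_pred] |
        simp add: size_enc_nat)+
  moreover have "fold (\<lambda>_ n. n - 1) (replicate j ()) i = i - j" for i j :: nat
    by (induction j arbitrary: i) simp_all
  ultimately show ?thesis by simp
qed

lemma polytime_le [polytime_intros]:
  assumes "polytime E enc_nat a" "polytime E enc_nat b"
  shows "polytime E enc_bool (\<lambda>x. a x \<le> b x)"
proof -
  have "polytime E enc_bool (\<lambda>x. replicate (a x - b x) () = [])" by (rule polytime_intros assms)+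
  then show ?thesis by simp
qed

lemma polytime_less [polytime_intros]:
  "polytime E enc_nat a \<Longrightarrow> polytime E enc_nat b \<Longrightarrow> polytime E enc_bool (\<lambda>x. a x < b x)"
  unfolding Suc_le_eq[symmetric] by (rule polytime_intros | assumption)+

lemma polytime_nat_eq [polytime_intros]:
  "polytime E enc_nat a \<Longrightarrow> polytime E enc_nat b \<Longrightarrow> polytime E enc_bool (\<lambda>x. a x = b x)"
  unfolding order_eq_iff by (rule polytime_intros | assumption)+

lemma polytime_min [polytime_intros]:
  "polytime E enc_nat a \<Longrightarrow> polytime E enc_nat b \<Longrightarrow> polytime E enc_nat (\<lambda>x. min (a x) (b x))"
  unfolding min_def by (rule polytime_intros | assumption)+

text \<open>Prepending \<open>n - 1\<close>, \<open>n - 2\<close>, \<open>\<dots>\<close>, \<open>0\<close> bounds the growth of each step by the size of the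
  input \<open>n\<close>, whereas appending \<open>0\<close>, \<open>1\<close>, \<open>\<dots>\<close> would only bound it by the accumulated list.\<close>

lemma polytime_upt [polytime_intros]:
  assumes "polytime E enc_nat n"
  shows "polytime E (enc_list enc_nat) (\<lambda>x. [0..<n x])"
proof -
  let ?step = "\<lambda>n (_::unit) l. (n - Suc (length l)) # l"
  have step: "polytime (enc_pair enc_nat (enc_pair enc_unit (enc_list enc_nat))) (enc_list enc_nat)
      (\<lambda>z. ?step (fst z) (fst (snd z)) (snd (snd z)))"
    by (rule polytime_intros)+
  have "polytime enc_nat (enc_list enc_nat) (\<lambda>n. fold (?step n) (replicate n ()) [])"
    by (rule polytime_fold[where q = Suc])
      (rule step polytime_intros nat_polynomial_intros | simp add: size_enc_nat)+
  moreover have "fold (?step n) (replicate j ()) [n - i..<n] = [n - (i + j)..<n]"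
    if "i + j \<le> n" for n i j
    using that
  proof (induction j arbitrary: i)
    case (Suc j)
    then have "(n - Suc i) # [n - i..<n] = [n - Suc i..<n]"
      by (simp add: upt_conv_Cons[of "n - Suc i"] Suc_diff_Suc)
    with Suc show ?case by simp
  qed simp
  from this[of 0] have "fold (?step n) (replicate n ()) [] = [0..<n]" for n by simp
  ultimately have "polytime enc_nat (enc_list enc_nat) (\<lambda>n. [0..<n])" by simp
  then show ?thesis using assms by (rule polytime_compose)
qed

lemma length_filter_less_upt:
  assumes "q \<le> n"
  shows "length (filter (\<lambda>i. i < q) [0..<n]) = q"
proof -
  have "{i. i < n \<and> [0..<n] ! i < q} = {..<q}" using assms by auto
  then show ?thesis by (simp add: length_filter_conv_card)
qed

lemma polytime_div [polytime_intros]: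
  assumes "polytime E enc_nat a" "polytime E enc_nat b"
  shows "polytime E enc_nat (\<lambda>x. a x div b x)"
proof -
  have "polytime E enc_nat
      (\<lambda>x. if b x = 0 then 0 else length (filter (\<lambda>i. Suc i * b x \<le> a x) [0..<a x]))"
    by (rule polytime_intros assms assms[THEN polytime_compose])+
  moreover have "(if n = 0 then 0 else length (filter (\<lambda>i. Suc i * n \<le> m) [0..<m])) = m div n"
    for m n :: nat
  proof (cases "n = 0")
    case False
    then have "Suc i * n \<le> m \<longleftrightarrow> i < m div n" for i
      using less_eq_div_iff_mult_less_eq[of n "Suc i" m] by (simp only: Suc_le_eq neq0_conv)
    then show ?thesis
      using False by (simp only: length_filter_less_upt[OF div_le_dividend] if_False)
  qed simp
  ultimately show ?thesis by (simp only:)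
qed

lemma polytime_mod [polytime_intros]:
  "polytime E enc_nat a \<Longrightarrow> polytime E enc_nat b \<Longrightarrow> polytime E enc_nat (\<lambda>x. a x mod b x)"
  unfolding minus_mult_div_eq_mod[symmetric] by (rule polytime_intros | assumption)+

text \<open>In unary notation, powers of two are only feasible up to a bound.\<close>

lemma polytime_min_power2 [polytime_intros]:
  assumes "polytime E enc_nat c" "polytime E enc_nat n"
  shows "polytime E enc_nat (\<lambda>x. min (c x) (2 ^ n x))"
proof -
  obtain p where poly_p: "nat_polynomial p" and size_c: "\<And>x. size (enc_nat (c x)) \<le> p (size (E x))"
    using assms(1) by (rule polytimeE) blast
  have "polytime E enc_nat (\<lambda>x. fold (\<lambda>_ m. min (c x) (2 * m)) (replicate (n x) ()) (min (c x) 1))"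
  proof (rule polytime_fold[where q = p])
    show "size (enc_nat (min (c x) (2 * m)))
        \<le> size (enc_nat m) + p (size (E x) + size (enc_unit y))" for x y m
      using size_c[of x] by (simp add: size_enc_nat)
  qed (rule poly_p polytime_intros assms assms[THEN polytime_compose])+
  moreover have "fold (\<lambda>_ m. min b (2 * m)) (replicate j ()) (min b (2 ^ i)) = min b (2 ^ (i + j))"
    for b i j :: nat
  proof (induction j arbitrary: i)
    case (Suc j)
    have "min b (2 * min b (2 ^ i)) = min b (2 ^ Suc i)" by auto
    with Suc.IH[of "Suc i"] show ?case by simp
  qed simp
  from this[where i = 0]
  have "fold (\<lambda>_ m. min b (2 * m)) (replicate j ()) (min b 1) = min b (2 ^ j)" for b j :: nat
    by simp
  ultimately show ?thesis by (simp only:)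
qed

lemma polytime_bit [polytime_intros]:
  assumes "polytime E enc_nat a" "polytime E enc_nat i"
  shows "polytime E enc_bool (\<lambda>x. bit (a x) (i x))"
proof -
  have "bit a i \<longleftrightarrow> a div min (Suc a) (2 ^ i) mod 2 = 1" for a i :: nat
    by (cases "2 ^ i \<le> a") (simp_all add: bit_iff_odd odd_iff_mod_2_eq_one min_def)
  then show ?thesis by (simp only:) (rule polytime_intros assms)+
qed

lemma polytime_floor_log [polytime_intros]:
  assumes "polytime E enc_nat a"
  shows "polytime E enc_nat (\<lambda>x. floor_log (a x))"
proof -
  have "polytime E enc_nat
      (\<lambda>x. length (filter (\<lambda>i. min (Suc (a x)) (2 ^ Suc i) \<le> a x) [0..<a x]))"
    by (rule polytime_intros assms assms[THEN polytime_compose])+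
  moreover have "length (filter (\<lambda>i. min (Suc n) (2 ^ Suc i) \<le> n) [0..<n]) = floor_log n" for n
  proof -
    have "min (Suc n) (2 ^ Suc i) \<le> n \<longleftrightarrow> i < floor_log n" for i
    proof
      assume "min (Suc n) (2 ^ Suc i) \<le> n"
      then have "floor_log (2 ^ Suc i) \<le> floor_log n" by (intro floor_log_le_iff) simp
      then show "i < floor_log n" by simp
    next
      assume i_less: "i < floor_log n"
      then have "2 ^ Suc i \<le> (2::nat) ^ floor_log n" by (intro power_increasing) simp_all
      also have "\<dots> \<le> n" using i_less by (intro floor_log_exp2_le) (auto intro: gr0I)
      finally show "min (Suc n) (2 ^ Suc i) \<le> n" by simp
    qed
    moreover have "floor_log n \<le> n"
      using floor_log_exp2_le[of n] less_exp[of "floor_log n"]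
      by (cases "n = 0") (auto simp del: less_exp)
    ultimately show ?thesis using length_filter_less_upt by simp
  qed
  ultimately show ?thesis by simp
qed

section \<open>Polynomial-time reductions\<close>

lemma runs_polytime_compose:
  assumes "polytime A B f"
  obtains p Q where "nat_polynomial p"
    "\<And>x t y. runs P (B (f x)) t y \<Longrightarrow> \<exists>t'. runs Q (A x) t' y \<and> t' \<le> p (size (A x)) + t"
proof -
  obtain p R where poly_p: "nat_polynomial p" and R: "computes A B f p 0 0 R"
    using assms by (rule polytimeE) blast
  define xs where "xs = sorted_list_of_set (assigned R - {0})"
  have set_xs: "set xs = assigned R - {0}" by (simp add: xs_def finite_assigned)
  show thesis
  proof (rule that)
    show "nat_polynomial (\<lambda>n. p n + (1 + 2 * length xs))" by (intro nat_polynomial_intros poly_p)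
    fix x t y
    assume "runs P (B (f x)) t y"
    then obtain s' where P: "exec P ((\<lambda>_. Nl)(0 := B (f x))) t s'" and y: "s' 0 = y"
      by (auto simp: runs_def)
    let ?s = "(\<lambda>_. Nl)(0 := A x)"
    obtain u r where R: "exec R ?s u r" and u: "u \<le> p (size (A x))" and r: "r 0 = B (f x)"
      using R[unfolded computes_def, rule_format, of ?s x] by (auto simp: halts_within_def)
    have "r i = Nl" if "i \<noteq> 0" "i \<notin> assigned R" for i
      using exec_not_assigned[OF R that(2)] that(1) by simp
    then have "(\<lambda>i. if i \<in> set xs then Nl else r i) = (\<lambda>_. Nl)(0 := B (f x))"
      using r by (auto simp: set_xs)
    then have "exec (clear xs) r (1 + 2 * length xs) ((\<lambda>_. Nl)(0 := B (f x)))"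
      using exec_clear[of xs r] by simp
    then have "exec (Seq R (Seq (clear xs) P)) ?s (u + (1 + 2 * length xs + t)) s'"
      using R P by (intro exec.Seq)
    then show "\<exists>t'. runs (Seq R (Seq (clear xs) P)) (A x) t' y \<and>
        t' \<le> p (size (A x)) + (1 + 2 * length xs) + t"
      using u y unfolding runs_def by (intro exI[of _ "u + (1 + 2 * length xs + t)"]) auto
  qed
qed

definition majorizes :: "('i \<Rightarrow> nat) set \<Rightarrow> (nat \<Rightarrow> nat) \<Rightarrow> ('i \<Rightarrow> real) \<Rightarrow> bool" where
  "majorizes X p q \<longleftrightarrow> (\<forall>i n. (\<forall>g \<in> X. g i \<le> n) \<longrightarrow> \<bar>q i\<bar> \<le> real (p n))"

lemma majorizesD: "majorizes X p q \<Longrightarrow> (\<And>g. g \<in> X \<Longrightarrow> g i \<le> n) \<Longrightarrow> \<bar>q i\<bar> \<le> real (p n)"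
  by (simp add: majorizes_def)

lemma majorizes_add:
  "majorizes X p q \<Longrightarrow> majorizes X p' q' \<Longrightarrow> majorizes X (\<lambda>n. p n + p' n) (\<lambda>i. q i + q' i)"
  unfolding majorizes_def by (auto intro!: order_trans[OF abs_triangle_ineq] add_mono)

lemma majorizes_mult:
  "majorizes X p q \<Longrightarrow> majorizes X p' q' \<Longrightarrow> majorizes X (\<lambda>n. p n * p' n) (\<lambda>i. q i * q' i)"
  unfolding majorizes_def by (auto intro!: mult_mono simp: abs_mult)

lemma ex_nat_polynomial_majorizes:
  assumes "polynomial_in X q"
  shows "\<exists>p. nat_polynomial p \<and> majorizes X p q"
  using assms
proof induction
  case (const c)
  have "\<bar>c\<bar> \<le> real (nat \<lceil>\<bar>c\<bar>\<rceil>)" by linarith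
  then show ?case unfolding majorizes_def using nat_polynomial.const by blast
next
  case (param g)
  then show ?case unfolding majorizes_def using nat_polynomial.id by fastforce
next
  case (add q r)
  then show ?case using nat_polynomial.add majorizes_add by blast
next
  case (mult q r)
  then show ?case using nat_polynomial.mult majorizes_mult by blast
qed

lemma polynomial_in_compose_nat_polynomial:
  assumes "nat_polynomial p" "polynomial_in X (\<lambda>i. real (r i))"
  shows "polynomial_in X (\<lambda>i. real (p (r i)))"
  using assms(1)
proof induction
  case (const c)
  show ?case by (rule polynomial_in.const)
qed (use assms(2) in \<open>auto intro: polynomial_in.add polynomial_in.mult\<close>)

lemma polynomial_in_mono: "polynomial_in X q \<Longrightarrow> X \<subseteq> Y \<Longrightarrow> polynomial_in Y q"
  by (induction rule: polynomial_in.induct) (auto intro: polynomial_in.intros)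

lemma solvable_in_Ostar_mono:
  "solvable_in_Ostar D ans X h \<Longrightarrow> X \<subseteq> Y \<Longrightarrow> solvable_in_Ostar D ans Y h"
  unfolding solvable_in_Ostar_def using polynomial_in_mono by blast

definition solvable_in_size ::
  "('i \<times> val) set \<Rightarrow> ('i \<Rightarrow> val \<Rightarrow> bool) \<Rightarrow> ('i \<times> val \<Rightarrow> real) \<Rightarrow> bool"
where
  "solvable_in_size D ans h \<longleftrightarrow> (\<exists>P p. nat_polynomial p \<and>
     (\<forall>(I, x) \<in> D. \<exists>t y. runs P x t y \<and> ans I y \<and> real t \<le> real (p (size x)) * h (I, x)))"

lemma solvable_in_Ostar_imp_solvable_in_size:
  assumes solvable: "solvable_in_Ostar D ans X h"
    and params: "\<And>g I x. g \<in> X \<Longrightarrow> (I, x) \<in> D \<Longrightarrow> g (I, x) \<le> size x"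
    and h_nonneg: "\<And>i. 0 \<le> h i"
  shows "solvable_in_size D ans h"
proof -
  obtain P q C where poly_q: "polynomial_in X q" and P: "\<And>I x. (I, x) \<in> D \<Longrightarrow>
      \<exists>t y. runs P x t y \<and> ans I y \<and> real t \<le> C * (q (I, x) * h (I, x))"
    using solvable unfolding solvable_in_Ostar_def by blast
  obtain p where poly_p: "nat_polynomial p" and p_majorizes: "majorizes X p q"
    using ex_nat_polynomial_majorizes[OF poly_q] by blast
  define r where "r n = nat \<lceil>\<bar>C\<bar>\<rceil> * p n" for n
  have time_le: "C * (q (I, x) * h (I, x)) \<le> real (r (size x)) * h (I, x)" if "(I, x) \<in> D" for I x
  proof -
    have "C * (q (I, x) * h (I, x)) \<le> \<bar>C\<bar> * (\<bar>q (I, x)\<bar> * h (I, x))"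
      using abs_ge_self[of "C * (q (I, x) * h (I, x))"] h_nonneg by (simp add: abs_mult)
    also have "\<dots> \<le> real (nat \<lceil>\<bar>C\<bar>\<rceil>) * (real (p (size x)) * h (I, x))"
      using h_nonneg params[OF _ that] by (intro mult_mono majorizesD[OF p_majorizes]) auto
    finally show ?thesis by (simp add: r_def mult.assoc)
  qed
  have "\<exists>t y. runs P x t y \<and> ans I y \<and> real t \<le> real (r (size x)) * h (I, x)"
    if "(I, x) \<in> D" for I x
    using P[OF that] time_le[OF that] by (meson order_trans)
  moreover have "nat_polynomial r" unfolding r_def by (intro nat_polynomial_intros poly_p)
  ultimately show ?thesis unfolding solvable_in_size_def by blast
qed

lemma solvable_in_size_imp_solvable_in_Ostar:
  assumes solvable: "solvable_in_size D ans h"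
    and poly_S: "polynomial_in X (\<lambda>i. real (S i))"
    and size_le: "\<And>I x. (I, x) \<in> D \<Longrightarrow> size x \<le> S (I, x)"
    and h_nonneg: "\<And>i. 0 \<le> h i"
  shows "solvable_in_Ostar D ans X h"
proof -
  obtain P p where poly_p: "nat_polynomial p" and P: "\<And>I x. (I, x) \<in> D \<Longrightarrow>
      \<exists>t y. runs P x t y \<and> ans I y \<and> real t \<le> real (p (size x)) * h (I, x)"
    using solvable unfolding solvable_in_size_def by blast
  have time_le: "real (p (size x)) * h (I, x) \<le> 1 * (real (p (S (I, x))) * h (I, x))"
    if "(I, x) \<in> D" for I x
    using h_nonneg nat_polynomial_mono[OF poly_p size_le[OF that]] by (simp add: mult_right_mono)
  have "\<exists>t y. runs P x t y \<and> ans I y \<and> real t \<le> 1 * (real (p (S (I, x))) * h (I, x))"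
    if "(I, x) \<in> D" for I x
    using P[OF that] time_le[OF that] by (meson order_trans)
  then show ?thesis
    unfolding solvable_in_Ostar_def
    using polynomial_in_compose_nat_polynomial[OF poly_p poly_S] by blast
qed

text \<open>A reduction may map an instance to one of many encodings of its image, so the map \<open>\<rho>\<close> on
  instances and the function \<open>R\<close> that produces the encoding are separate.\<close>

lemma solvable_in_size_reduction:
  assumes R: "polytime A B R"
    and input: "\<And>I x. (I, x) \<in> D \<Longrightarrow> x = A I \<and> (\<rho> I, B (R I)) \<in> D'"
    and answer: "\<And>I x y. (I, x) \<in> D \<Longrightarrow> ans' (\<rho> I) y \<Longrightarrow> ans I y"
    and h_le: "\<And>I x. (I, x) \<in> D \<Longrightarrow> h' (\<rho> I, B (R I)) \<le> h (I, x)" and h_ge_1: "\<And>i. 1 \<le> h i"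
    and solvable: "solvable_in_size D' ans' h'"
  shows "solvable_in_size D ans h"
proof -
  obtain P p where poly_p: "nat_polynomial p" and P: "\<And>I x. (I, x) \<in> D' \<Longrightarrow>
      \<exists>t y. runs P x t y \<and> ans' I y \<and> real t \<le> real (p (size x)) * h' (I, x)"
    using solvable unfolding solvable_in_size_def by blast
  obtain r where poly_r: "nat_polynomial r" and size_R: "\<And>I. size (B (R I)) \<le> r (size (A I))"
    using R by (rule polytimeE) blast
  obtain q Q where poly_q: "nat_polynomial q" and Q: "\<And>I t y. runs P (B (R I)) t y \<Longrightarrow>
      \<exists>t'. runs Q (A I) t' y \<and> t' \<le> q (size (A I)) + t"
    using runs_polytime_compose[OF R] by blast
  have "\<exists>t y. runs Q x t y \<and> ans I y \<and> real t \<le> real (q (size x) + p (r (size x))) * h (I, x)"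
    if D: "(I, x) \<in> D" for I x
  proof -
    have x: "x = A I" and D': "(\<rho> I, B (R I)) \<in> D'" using input[OF D] by auto
    obtain t y where "runs P (B (R I)) t y" and ans': "ans' (\<rho> I) y"
        and t_le: "real t \<le> real (p (size (B (R I)))) * h' (\<rho> I, B (R I))"
      using P[OF D'] by blast
    then obtain t' where run: "runs Q x t' y" and t'_le: "t' \<le> q (size x) + t"
      using Q unfolding x by blast
    note t_le
    also have "real (p (size (B (R I)))) * h' (\<rho> I, B (R I)) \<le> real (p (size (B (R I)))) * h (I, x)"
      using h_le[OF D] by (intro mult_left_mono) auto
    also have "\<dots> \<le> real (p (r (size x))) * h (I, x)"
      using nat_polynomial_mono[OF poly_p size_R] order_trans[OF zero_le_one h_ge_1]
      by (intro mult_right_mono) (auto simp: x)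
    finally have "real t \<le> real (p (r (size x))) * h (I, x)" .
    moreover have "real (q (size x)) \<le> real (q (size x)) * h (I, x)"
      using h_ge_1 by (simp add: mult_le_cancel_left1)
    ultimately have "real t' \<le> real (q (size x) + p (r (size x))) * h (I, x)"
      using t'_le by (simp add: distrib_right)
    then show ?thesis using run answer[OF D ans'] by blast
  qed
  moreover have "nat_polynomial (\<lambda>n. q n + p (r n))"
    by (intro nat_polynomial_intros nat_polynomial_compose[OF poly_p] poly_q poly_r)
  ultimately show ?thesis unfolding solvable_in_size_def by blast
qed

section \<open>Listed WSP instances\<close>

type_synonym listed_constraint = "nat list \<times> nat list list"
type_synonym listed_wsp = "nat \<times> nat \<times> nat list list \<times> listed_constraint list"

fun constraint_of :: "nat \<Rightarrow> listed_constraint \<Rightarrow> (nat, nat) wsp_constraint" where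
  "constraint_of n (ls, ts) = (set ls, {\<theta> \<in> set ls \<rightarrow>\<^sub>E {..<n}. map \<theta> ls \<in> set ts})"

fun wsp_of :: "listed_wsp \<Rightarrow> (nat, nat) wsp" where
  "wsp_of (k, n, as, cs) = \<lparr>tasks = {..<k}, users = {..<n}, auth = (\<lambda>s. set (as ! s)),
     constraints = constraint_of n ` set cs\<rparr>"

abbreviation enc_constraint :: "listed_constraint \<Rightarrow> val" where
  "enc_constraint \<equiv> enc_pair (enc_list enc_nat) (enc_list (enc_list enc_nat))"

fun enc_wsp :: "listed_wsp \<Rightarrow> val" where
  "enc_wsp (k, n, as, cs) = enc_list (\<lambda>v. v)
     [enc_nat k, enc_nat n, enc_list (enc_list enc_nat) as, enc_list enc_constraint cs]"

fun ui_constraint :: "nat \<Rightarrow> nat \<Rightarrow> listed_constraint \<Rightarrow> bool" where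
  "ui_constraint k n (ls, ts) \<longleftrightarrow> distinct ls \<and> set ls \<subseteq> {..<k} \<and> distinct ts \<and>
     (\<forall>t \<in> set ts. length t = length ls \<and> set t \<subseteq> {..<n} \<and>
       (\<forall>\<psi>. \<psi> permutes {..<n} \<longrightarrow> map \<psi> t \<in> set ts))"

fun ui_wsp :: "listed_wsp \<Rightarrow> bool" where
  "ui_wsp (k, n, as, cs) \<longleftrightarrow> length as = k \<and> (\<forall>a \<in> set as. distinct a \<and> set a \<subseteq> {..<n}) \<and>
     distinct (map (\<lambda>c. set (fst c)) cs) \<and> (\<forall>c \<in> set cs. ui_constraint k n c)"

lemma ex_extensional_map_eq:
  assumes "distinct ls" "length t = length ls" "set t \<subseteq> X"
  shows "\<exists>\<theta> \<in> set ls \<rightarrow>\<^sub>E X. map \<theta> ls = t"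
proof -
  let ?\<theta> = "restrict (\<lambda>x. the (map_of (zip ls t) x)) (set ls)"
  have map_eq: "map ?\<theta> ls = t"
    using map_of_zip_nth[OF assms(2)[symmetric] assms(1)] assms(2) by (auto intro!: nth_equalityI)
  then have "?\<theta> ` set ls = set t" by (metis image_set)
  with assms(3) have "?\<theta> x \<in> X" if "x \<in> set ls" for x using that by blast
  then have "?\<theta> \<in> set ls \<rightarrow>\<^sub>E X" by (intro PiE_I) auto
  with map_eq show ?thesis by (rule bexI)
qed

lemma encodes_constraint_of:
  assumes "ui_constraint k n c"
  shows "encodes_constraint (constraint_of n c) (enc_constraint c)"
proof -
  obtain ls ts where c: "c = (ls, ts)" by (cases c)
  let ?\<Theta> = "{\<theta> \<in> set ls \<rightarrow>\<^sub>E {..<n}. map \<theta> ls \<in> set ts}"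
  have "set ts \<subseteq> (\<lambda>\<theta>. map \<theta> ls) ` ?\<Theta>"
  proof
    fix t assume t_mem: "t \<in> set ts"
    then obtain \<theta> where "\<theta> \<in> set ls \<rightarrow>\<^sub>E {..<n}" "map \<theta> ls = t"
      using ex_extensional_map_eq[of ls t "{..<n}"] assms by (auto simp: c)
    with t_mem show "t \<in> (\<lambda>\<theta>. map \<theta> ls) ` ?\<Theta>" by blast
  qed
  then have "lists_set ts ((\<lambda>\<theta>. map \<theta> ls) ` ?\<Theta>)" "lists_set ls (set ls)"
    using assms by (auto simp: c lists_set_def)
  then show ?thesis by (auto simp: c enc_pair_def)
qed

lemma user_independent_constraint_of:
  assumes "ui_constraint k n c" "users W = {..<n}"
  shows "user_independent W (constraint_of n c)"
proof -
  obtain ls ts where c: "c = (ls, ts)" by (cases c)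
  show ?thesis
    unfolding user_independent_def
  proof (intro ballI allI impI)
    fix \<theta> \<psi> assume \<theta>: "\<theta> \<in> snd (constraint_of n c)" and \<psi>: "\<psi> permutes users W"
    have map_compose: "map (compose (set ls) \<psi> \<theta>) ls = map \<psi> (map \<theta> ls)"
      by (simp add: compose_def)
    have "map \<psi> (map \<theta> ls) \<in> set ts"
      using \<theta> \<psi> assms by (auto simp: c)
    moreover have "compose (set ls) \<psi> \<theta> \<in> set ls \<rightarrow>\<^sub>E {..<n}"
      using \<theta> permutes_in_image[OF \<psi>] assms(2) by (auto simp: c compose_def)
    ultimately show "compose (fst (constraint_of n c)) \<psi> \<theta> \<in> snd (constraint_of n c)"
      unfolding c constraint_of.simps fst_conv snd_conv mem_Collect_eq map_compose
      by blast
  qed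
qed

lemma ui_wsp_inputsI:
  assumes "ui_wsp w"
  shows "(wsp_of w, enc_wsp w) \<in> ui_wsp_inputs"
proof -
  obtain k n as cs where w: "w = (k, n, as, cs)" by (cases w)
  have ui_constraints: "ui_constraint k n c" if "c \<in> set cs" for c using assms that by (simp add: w)
  have fst_constraint_of: "fst (constraint_of n c) = set (fst c)" for c by (cases c) simp
  have "wsp_instance (wsp_of w)"
    using assms ui_constraints by (fastforce simp: wsp_instance_def w)
  moreover have "\<forall>c \<in> constraints (wsp_of w). user_independent (wsp_of w) c"
    using user_independent_constraint_of[OF ui_constraints] by (auto simp: w)
  moreover have "encodes_wsp (wsp_of w) (enc_wsp w)"
    unfolding encodes_wsp_def
  proof (intro exI conjI)
    show "\<forall>s<k. lists_set (as ! s) (auth (wsp_of w) s)" using assms by (simp add: w lists_set_def)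
    have "distinct (map fst (map (constraint_of n) cs))"
      using assms by (simp add: w fst_constraint_of comp_def)
    then show "lists_set (map (constraint_of n) cs) (constraints (wsp_of w))"
      by (simp add: w lists_set_def distinct_map del: map_map)
    show "list_all2 encodes_constraint (map (constraint_of n) cs) (map enc_constraint cs)"
      unfolding list.rel_map list_all2_same using encodes_constraint_of[OF ui_constraints] by blast
    have "enc_list enc_constraint xs = enc_list (\<lambda>v. v) (map enc_constraint xs)" for xs
      by (induction xs) simp_all
    then show "enc_wsp w = enc_list (\<lambda>v. v) [enc_nat k, enc_nat n, enc_list (enc_list enc_nat) as,
        enc_list (\<lambda>v. v) (map enc_constraint cs)]"
      by (simp add: w)
  qed (use assms in \<open>simp_all add: w\<close>)
  ultimately show ?thesis by (simp add: ui_wsp_inputs_def)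
qed

lemma valid_complete_plan_wsp_of_iff:
  assumes "ui_wsp (k, n, as, cs)"
  shows "valid_complete_plan (wsp_of (k, n, as, cs)) \<pi> \<longleftrightarrow> \<pi> \<in> {..<k} \<rightarrow>\<^sub>E {..<n} \<and>
    (\<forall>s<k. \<pi> s \<in> set (as ! s)) \<and> (\<forall>(ls, ts) \<in> set cs. map \<pi> ls \<in> set ts)"
proof (cases "\<pi> \<in> {..<k} \<rightarrow>\<^sub>E {..<n}")
  case True
  have "satisfies {..<k} \<pi> (constraint_of n (ls, ts)) \<longleftrightarrow> map \<pi> ls \<in> set ts"
    if "(ls, ts) \<in> set cs" for ls ts
  proof -
    have "ui_constraint k n (ls, ts)" using assms that unfolding ui_wsp.simps by blast
    then have scope: "set ls \<subseteq> {..<k}" by simp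
    then have "restrict \<pi> (set ls) \<in> set ls \<rightarrow>\<^sub>E {..<n}" using True by auto
    moreover have map_restrict: "map (restrict \<pi> (set ls)) ls = map \<pi> ls" by simp
    ultimately show ?thesis
      using scope unfolding satisfies_def constraint_of.simps fst_conv snd_conv mem_Collect_eq
        map_restrict by blast
  qed
  then have "eligible (wsp_of (k, n, as, cs)) {..<k} \<pi> \<longleftrightarrow> (\<forall>(ls, ts) \<in> set cs. map \<pi> ls \<in> set ts)"
    unfolding eligible_def by (auto simp del: constraint_of.simps)
  with True show ?thesis
    by (auto simp: valid_complete_plan_def plan_def valid_def authorized_def)
qed (auto simp: valid_complete_plan_def plan_def)

lemma ui_wsp_parameter_le_size:
  assumes "g \<in> {num_users, num_tasks, num_constraints, input_length}" "(W, x) \<in> ui_wsp_inputs"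
  shows "g (W, x) \<le> size x"
proof -
  obtain k n as cs xs where tasks: "tasks W = {..<k}" and users: "users W = {..<n}"
    and cs: "lists_set cs (constraints W)" and xs: "list_all2 encodes_constraint cs xs"
    and x: "x = enc_list (\<lambda>v. v)
      [enc_nat k, enc_nat n, enc_list (enc_list enc_nat) as, enc_list (\<lambda>v. v) xs]"
    using assms(2) by (auto simp: ui_wsp_inputs_def encodes_wsp_def)
  have "card (constraints W) = length xs"
    using cs distinct_card[of cs] list_all2_lengthD[OF xs] by (simp add: lists_set_def)
  then show ?thesis
    using assms(1) length_le_size_enc_list[of xs "\<lambda>v. v"]
    by (auto simp: num_users_def num_tasks_def num_constraints_def input_length_def tasks users x
        size_enc_nat)
qed

lemma polytime_enc_wsp [polytime_intros]:
  assumes "polytime E enc_nat k" "polytime E enc_nat n"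
    "polytime E (enc_list (enc_list enc_nat)) as" "polytime E (enc_list enc_constraint) cs"
  shows "polytime E enc_wsp (\<lambda>x. (k x, n x, as x, cs x))"
proof -
  have "polytime E (enc_pair enc_nat (enc_pair enc_nat (enc_pair (enc_list (enc_list enc_nat))
      (enc_pair (enc_list enc_constraint) enc_unit)))) (\<lambda>x. (k x, n x, as x, cs x, ()))"
    by (rule polytime_intros assms)+
  then show ?thesis by (rule polytime_recode) (simp add: enc_pair_def)
qed

section \<open>From ternary nogoods to WSP\<close>

text \<open>A slot \<open>(j, i)\<close> stands for the event that variable \<open>j\<close> takes the value \<open>i\<close>.\<close>

type_synonym slot = "nat \<times> nat"
type_synonym nogood = "slot \<times> slot \<times> slot"

abbreviation enc_slot :: "slot \<Rightarrow> val" where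
  "enc_slot \<equiv> enc_pair enc_nat enc_nat"

abbreviation enc_nogood :: "nogood \<Rightarrow> val" where
  "enc_nogood \<equiv> enc_pair enc_slot (enc_pair enc_slot enc_slot)"

fun avoids :: "(nat \<Rightarrow> nat) \<Rightarrow> nogood \<Rightarrow> bool" where
  "avoids g ((j\<^sub>1, i\<^sub>1), (j\<^sub>2, i\<^sub>2), (j\<^sub>3, i\<^sub>3)) \<longleftrightarrow> \<not> (g j\<^sub>1 = i\<^sub>1 \<and> g j\<^sub>2 = i\<^sub>2 \<and> g j\<^sub>3 = i\<^sub>3)"

definition all_nogoods :: "nat \<Rightarrow> nat \<Rightarrow> nogood list" where
  "all_nogoods k n = (let S = List.product [0..<k] [0..<n] in List.product S (List.product S S))"

text \<open>With \<open>m = k + n\<close>, task \<open>j < k\<close> stands for variable \<open>j\<close>, task \<open>k + i < m\<close> is the anchor of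
  user \<open>i\<close>, and tasks \<open>m + s\<close> and \<open>2 * m + s\<close> are copies of task \<open>s\<close>.\<close>

fun nogood_scope :: "nat \<Rightarrow> nat \<Rightarrow> nogood \<Rightarrow> nat list" where
  "nogood_scope k n ((j\<^sub>1, i\<^sub>1), (j\<^sub>2, i\<^sub>2), (j\<^sub>3, i\<^sub>3)) = (let m = k + n in
     [j\<^sub>1, k + i\<^sub>1, m + j\<^sub>2, m + (k + i\<^sub>2), 2 * m + j\<^sub>3, 2 * m + (k + i\<^sub>3)])"

definition nogood_vectors :: "nat \<Rightarrow> nat list list" where
  "nogood_vectors n = map (\<lambda>((x, a), (y, b), (z, c)). [x, a, y, b, z, c])
     (filter (\<lambda>((x, a), (y, b), (z, c)). \<not> (x = a \<and> y = b \<and> z = c)) (all_nogoods n n))"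

definition copy_scope :: "nat \<Rightarrow> nat \<Rightarrow> nat list" where
  "copy_scope m s = [s, m + s, 2 * m + s]"

definition constant_vectors :: "nat \<Rightarrow> nat list list" where
  "constant_vectors n = map (\<lambda>u. [u, u, u]) [0..<n]"

definition nogood_constraints :: "nat \<Rightarrow> nat \<Rightarrow> nogood list \<Rightarrow> listed_constraint list" where
  "nogood_constraints k n qs = map (\<lambda>q. (nogood_scope k n q, nogood_vectors n)) qs @
     map (\<lambda>s. (copy_scope (k + n) s, constant_vectors n)) [0..<k + n]"

definition nogood_auth :: "nat \<Rightarrow> nat \<Rightarrow> nat list list" where
  "nogood_auth k n = map (\<lambda>s. let r = s mod (k + n) in if r < k then [0..<n] else [r - k])
     [0..<3 * (k + n)]"

definition nogood_wsp :: "nat \<Rightarrow> nat \<Rightarrow> nogood list \<Rightarrow> listed_wsp" where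
  "nogood_wsp k n qs = (3 * (k + n), n, nogood_auth k n, nogood_constraints k n qs)"

lemma set_all_nogoods:
  "set (all_nogoods k n) = {((j\<^sub>1, i\<^sub>1), (j\<^sub>2, i\<^sub>2), (j\<^sub>3, i\<^sub>3)) | j\<^sub>1 i\<^sub>1 j\<^sub>2 i\<^sub>2 j\<^sub>3 i\<^sub>3.
     j\<^sub>1 < k \<and> i\<^sub>1 < n \<and> j\<^sub>2 < k \<and> i\<^sub>2 < n \<and> j\<^sub>3 < k \<and> i\<^sub>3 < n}"
  by (auto simp: all_nogoods_def Let_def)

lemma distinct_all_nogoods: "distinct (all_nogoods k n)"
  by (auto simp: all_nogoods_def Let_def intro!: distinct_product)

lemma set_nogood_vectors:
  "set (nogood_vectors n) = {[x, a, y, b, z, c] | x a y b z c.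
     x < n \<and> a < n \<and> y < n \<and> b < n \<and> z < n \<and> c < n \<and> \<not> (x = a \<and> y = b \<and> z = c)}"
  by (auto simp: nogood_vectors_def set_all_nogoods image_iff)

lemma set_constant_vectors: "set (constant_vectors n) = {[u, u, u] | u. u < n}"
  by (auto simp: constant_vectors_def)

lemma ui_constraint_nogood:
  assumes "q \<in> set (all_nogoods k n)"
  shows "ui_constraint (3 * (k + n)) n (nogood_scope k n q, nogood_vectors n)"
proof -
  have "map \<psi> v \<in> set (nogood_vectors n)"
    if "\<psi> permutes {..<n}" "v \<in> set (nogood_vectors n)" for \<psi> v
    using that permutes_inj[OF that(1)] permutes_in_image[OF that(1)]
    unfolding set_nogood_vectors by (auto simp: inj_eq)
  moreover have "distinct (nogood_vectors n)"
    using distinct_all_nogoods by (auto simp: nogood_vectors_def distinct_map inj_on_def)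
  ultimately show ?thesis
    using assms by (auto simp: set_all_nogoods set_nogood_vectors Let_def)
qed

lemma ui_constraint_copy:
  assumes "s < m"
  shows "ui_constraint (3 * m) n (copy_scope m s, constant_vectors n)"
proof -
  have "distinct (constant_vectors n)"
    by (auto simp: constant_vectors_def distinct_map inj_on_def)
  then show ?thesis
    using assms permutes_in_image by (fastforce simp: copy_scope_def set_constant_vectors)
qed

lemma distinct_nogood_scopes:
  assumes "distinct qs" "set qs \<subseteq> set (all_nogoods k n)"
  shows "distinct (map (\<lambda>c. set (fst c)) (nogood_constraints k n qs))"
proof -
  let ?scopes = "map (nogood_scope k n) qs @ map (copy_scope (k + n)) [0..<k + n]"
  have "inj (nogood_scope k n)"
  proof (rule injI)
    show "q = q'" if "nogood_scope k n q = nogood_scope k n q'" for q q'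
      using that by (cases q; cases q'; auto simp: Let_def)
  qed
  moreover have "inj (copy_scope (k + n))" by (auto simp: inj_def copy_scope_def)
  moreover have "nogood_scope k n q \<noteq> copy_scope (k + n) s" for q s
    by (cases q) (auto simp: copy_scope_def Let_def)
  ultimately have "distinct ?scopes"
    using assms(1) by (auto simp: distinct_map intro: inj_on_subset)
  moreover have "sorted_wrt (<) ls" if "ls \<in> set ?scopes" for ls
    using that assms(2) by (auto simp: set_all_nogoods copy_scope_def Let_def)
  then have "inj_on set (set ?scopes)"
    by (intro inj_onI strict_sorted_equal) simp_all
  ultimately have "distinct (map set ?scopes)" by (simp only: distinct_map)
  then show ?thesis by (simp add: nogood_constraints_def comp_def)
qed

lemma ui_wsp_nogood_wsp:
  assumes "distinct qs" "set qs \<subseteq> set (all_nogoods k n)"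
  shows "ui_wsp (nogood_wsp k n qs)"
proof -
  have "s mod (k + n) < k + n" if "s < 3 * (k + n)" for s
    using that by (intro mod_less_divisor) (rule gr0I, simp)
  then have "\<forall>a \<in> set (nogood_auth k n). distinct a \<and> set a \<subseteq> {..<n}"
    by (auto simp: nogood_auth_def Let_def not_less less_diff_conv2 add.commute
        simp del: distrib_left_numeral)
  moreover have "\<forall>c \<in> set (nogood_constraints k n qs). ui_constraint (3 * (k + n)) n c"
    using assms(2) ui_constraint_nogood ui_constraint_copy
    by (auto simp: nogood_constraints_def simp del: ui_constraint.simps distrib_left_numeral)
  ultimately show ?thesis
    using distinct_nogood_scopes[OF assms] by (simp add: nogood_wsp_def nogood_auth_def)
qed

lemma valid_complete_plan_nogood_wsp_iff:
  assumes "distinct qs" "set qs \<subseteq> set (all_nogoods k n)"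
  shows "valid_complete_plan (wsp_of (nogood_wsp k n qs)) \<pi> \<longleftrightarrow>
    \<pi> \<in> {..<3 * (k + n)} \<rightarrow>\<^sub>E {..<n} \<and>
    (\<forall>s < 3 * (k + n). k \<le> s mod (k + n) \<longrightarrow> \<pi> s = s mod (k + n) - k) \<and>
    (\<forall>q \<in> set qs. map \<pi> (nogood_scope k n q) \<in> set (nogood_vectors n)) \<and>
    (\<forall>s < k + n. \<pi> (k + n + s) = \<pi> s \<and> \<pi> (2 * (k + n) + s) = \<pi> s)"
  (is "_ \<longleftrightarrow> ?\<pi> \<and> ?anchors \<and> ?nogoods \<and> ?copies")
proof -
  have constraints:
    "(\<forall>(ls, ts) \<in> set (nogood_constraints k n qs). map \<pi> ls \<in> set ts) \<longleftrightarrow> ?nogoods \<and> ?copies" if ?\<pi>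
  proof -
    have "map \<pi> (copy_scope (k + n) s) \<in> set (constant_vectors n) \<longleftrightarrow>
        \<pi> (k + n + s) = \<pi> s \<and> \<pi> (2 * (k + n) + s) = \<pi> s" if "s < k + n" for s
      using PiE_mem[OF \<open>?\<pi>\<close>, of s] that by (auto simp: copy_scope_def set_constant_vectors)
    then show ?thesis
      by (simp add: nogood_constraints_def ball_Un Ball_def[of "{0..<k + n}"]
          del: distrib_left_numeral)
  qed
  have auth: "(\<forall>s < 3 * (k + n). \<pi> s \<in> set (nogood_auth k n ! s)) \<longleftrightarrow> ?anchors" if ?\<pi>
    using PiE_mem[OF that] by (auto simp: nogood_auth_def Let_def not_less)
  show ?thesis
    unfolding nogood_wsp_def
      valid_complete_plan_wsp_of_iff[OF ui_wsp_nogood_wsp[OF assms, unfolded nogood_wsp_def]]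
    using constraints auth by blast
qed

lemma avoids_if_valid_complete_plan:
  assumes "distinct qs" "set qs \<subseteq> set (all_nogoods k n)"
    and "valid_complete_plan (wsp_of (nogood_wsp k n qs)) \<pi>" "q \<in> set qs"
  shows "avoids \<pi> q"
proof -
  obtain j\<^sub>1 i\<^sub>1 j\<^sub>2 i\<^sub>2 j\<^sub>3 i\<^sub>3 where q: "q = ((j\<^sub>1, i\<^sub>1), (j\<^sub>2, i\<^sub>2), (j\<^sub>3, i\<^sub>3))"
    and less: "j\<^sub>1 < k" "i\<^sub>1 < n" "j\<^sub>2 < k" "i\<^sub>2 < n" "j\<^sub>3 < k" "i\<^sub>3 < n"
    using assms(2,4) by (auto simp: set_all_nogoods)
  have "\<forall>s < 3 * (k + n). k \<le> s mod (k + n) \<longrightarrow> \<pi> s = s mod (k + n) - k"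
    using assms(3) unfolding valid_complete_plan_nogood_wsp_iff[OF assms(1,2)] by blast
  then have anchor: "\<pi> (k + i) = i" if "i < n" for i
    using that by (auto dest: spec[of _ "k + i"])
  have copies: "\<pi> (k + n + s) = \<pi> s" "\<pi> (2 * (k + n) + s) = \<pi> s" if "s < k + n" for s
    using assms(3) that unfolding valid_complete_plan_nogood_wsp_iff[OF assms(1,2)] by blast+
  have "map \<pi> (nogood_scope k n q) = [\<pi> j\<^sub>1, i\<^sub>1, \<pi> j\<^sub>2, i\<^sub>2, \<pi> j\<^sub>3, i\<^sub>3]"
    using less by (simp add: q Let_def copies anchor del: distrib_left_numeral)
  moreover have "map \<pi> (nogood_scope k n q) \<in> set (nogood_vectors n)"
    using assms(3,4) unfolding valid_complete_plan_nogood_wsp_iff[OF assms(1,2)] by blast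
  ultimately show ?thesis by (auto simp: q set_nogood_vectors)
qed

lemma ex_valid_complete_plan_if_avoids:
  assumes "distinct qs" "set qs \<subseteq> set (all_nogoods k n)"
    and g_range: "g \<in> {..<k} \<rightarrow> {..<n}" and g_avoids: "\<And>q. q \<in> set qs \<Longrightarrow> avoids g q"
  shows "\<exists>\<pi>. valid_complete_plan (wsp_of (nogood_wsp k n qs)) \<pi>"
proof -
  define \<pi> where
    "\<pi> = (\<lambda>s \<in> {..<3 * (k + n)}. let r = s mod (k + n) in if r < k then g r else r - k)"
  have less: "\<pi> s < n" if "s < 3 * (k + n)" for s
  proof -
    have "s mod (k + n) < k + n" using that by (intro mod_less_divisor) (rule gr0I, simp)
    then show ?thesis using that g_range by (auto simp: \<pi>_def Let_def)
  qed
  have copies: "\<pi> (k + n + s) = \<pi> s" "\<pi> (2 * (k + n) + s) = \<pi> s" if "s < k + n" for s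
  proof -
    have "s < 3 * (k + n)" "k + n + s < 3 * (k + n)" "2 * (k + n) + s < 3 * (k + n)"
      using that by simp_all
    then show "\<pi> (k + n + s) = \<pi> s" "\<pi> (2 * (k + n) + s) = \<pi> s"
      using that by (simp_all add: \<pi>_def del: distrib_left_numeral)
  qed
  have base: "\<pi> j = g j" "\<pi> (k + i) = i" if "j < k" "i < n" for i j
    using that by (simp_all add: \<pi>_def)
  have "map \<pi> (nogood_scope k n q) \<in> set (nogood_vectors n)" if q_mem: "q \<in> set qs" for q
  proof -
    obtain j\<^sub>1 i\<^sub>1 j\<^sub>2 i\<^sub>2 j\<^sub>3 i\<^sub>3 where q: "q = ((j\<^sub>1, i\<^sub>1), (j\<^sub>2, i\<^sub>2), (j\<^sub>3, i\<^sub>3))"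
      and ji_less: "j\<^sub>1 < k" "i\<^sub>1 < n" "j\<^sub>2 < k" "i\<^sub>2 < n" "j\<^sub>3 < k" "i\<^sub>3 < n"
      using assms(2) q_mem by (auto simp: set_all_nogoods)
    have "map \<pi> (nogood_scope k n q) = [g j\<^sub>1, i\<^sub>1, g j\<^sub>2, i\<^sub>2, g j\<^sub>3, i\<^sub>3]"
      using ji_less by (simp add: q Let_def copies base del: distrib_left_numeral)
    then show ?thesis using ji_less g_range g_avoids[OF q_mem] by (auto simp: set_nogood_vectors q)
  qed
  moreover have "\<pi> \<in> {..<3 * (k + n)} \<rightarrow>\<^sub>E {..<n}"
    using less by (auto simp: \<pi>_def)
  moreover have "\<forall>s < 3 * (k + n). k \<le> s mod (k + n) \<longrightarrow> \<pi> s = s mod (k + n) - k"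
    by (simp add: \<pi>_def Let_def)
  ultimately have "valid_complete_plan (wsp_of (nogood_wsp k n qs)) \<pi>"
    unfolding valid_complete_plan_nogood_wsp_iff[OF assms(1,2)] using copies by blast
  then show ?thesis by blast
qed

lemma ex_valid_complete_plan_nogood_wsp_iff:
  assumes "distinct qs" "set qs \<subseteq> set (all_nogoods k n)"
  shows "(\<exists>\<pi>. valid_complete_plan (wsp_of (nogood_wsp k n qs)) \<pi>) \<longleftrightarrow>
    (\<exists>g \<in> {..<k} \<rightarrow> {..<n}. \<forall>q \<in> set qs. avoids g q)"
proof
  assume "\<exists>\<pi>. valid_complete_plan (wsp_of (nogood_wsp k n qs)) \<pi>"
  then obtain \<pi> where \<pi>: "valid_complete_plan (wsp_of (nogood_wsp k n qs)) \<pi>" by blast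
  then have range: "\<pi> \<in> {..<3 * (k + n)} \<rightarrow>\<^sub>E {..<n}"
    unfolding valid_complete_plan_nogood_wsp_iff[OF assms] by blast
  have "\<pi> \<in> {..<k} \<rightarrow> {..<n}"
    using PiE_mem[OF range] by (intro Pi_I) simp
  with avoids_if_valid_complete_plan[OF assms \<pi>]
  show "\<exists>g \<in> {..<k} \<rightarrow> {..<n}. \<forall>q \<in> set qs. avoids g q" by blast
next
  assume "\<exists>g \<in> {..<k} \<rightarrow> {..<n}. \<forall>q \<in> set qs. avoids g q"
  then obtain g where "g \<in> {..<k} \<rightarrow> {..<n}" "\<forall>q \<in> set qs. avoids g q" by blast
  then show "\<exists>\<pi>. valid_complete_plan (wsp_of (nogood_wsp k n qs)) \<pi>"
    by (intro ex_valid_complete_plan_if_avoids[OF assms]) blast+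
qed

lemma polytime_all_nogoods [polytime_intros]:
  assumes "polytime E enc_nat k" "polytime E enc_nat n"
  shows "polytime E (enc_list enc_nogood) (\<lambda>x. all_nogoods (k x) (n x))"
  unfolding all_nogoods_def Let_def by (rule polytime_intros assms)+

lemma polytime_nogood_vectors [polytime_intros]:
  assumes "polytime E enc_nat n"
  shows "polytime E (enc_list (enc_list enc_nat)) (\<lambda>x. nogood_vectors (n x))"
  unfolding nogood_vectors_def case_prod_unfold by (rule polytime_intros assms)+

lemma polytime_nogood_wsp [polytime_intros]:
  assumes "polytime E enc_nat k" "polytime E enc_nat n"
    "polytime E (enc_list enc_nogood) qs"
  shows "polytime E enc_wsp (\<lambda>x. nogood_wsp (k x) (n x) (qs x))"
proof -
  have scope: "nogood_scope i j q = (let m = i + j in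
     [fst (fst q), i + snd (fst q), m + fst (fst (snd q)), m + (i + snd (fst (snd q))),
      2 * m + fst (snd (snd q)), 2 * m + (i + snd (snd (snd q)))])" for i j q
    by (cases q) auto
  show ?thesis
    unfolding nogood_wsp_def nogood_auth_def nogood_constraints_def copy_scope_def
      constant_vectors_def scope Let_def
    by (rule polytime_intros assms assms[THEN polytime_compose])+
qed

section \<open>From 3-SAT to ternary nogoods\<close>

text \<open>Variable \<open>v\<close> of the formula belongs to group \<open>v div b\<close>, and the value \<open>i < 2 ^ b\<close> of a group
  assigns bit \<open>v mod b\<close> of \<open>i\<close> to it.\<close>

fun slot_falsifies :: "nat \<Rightarrow> slot \<Rightarrow> literal \<Rightarrow> bool" where
  "slot_falsifies b (j, i) (c, v) \<longleftrightarrow> v div b = j \<and> bit i (v mod b) \<noteq> c"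

fun nogood_falsifies :: "nat \<Rightarrow> nogood \<Rightarrow> clause \<Rightarrow> bool" where
  "nogood_falsifies b (p\<^sub>1, p\<^sub>2, p\<^sub>3) (l\<^sub>1, l\<^sub>2, l\<^sub>3) \<longleftrightarrow>
     slot_falsifies b p\<^sub>1 l\<^sub>1 \<and> slot_falsifies b p\<^sub>2 l\<^sub>2 \<and> slot_falsifies b p\<^sub>3 l\<^sub>3"

text \<open>Nogoods are filtered rather than generated from the clauses, so that none is repeated.\<close>

definition clause_nogoods :: "nat \<Rightarrow> nat \<Rightarrow> nat \<Rightarrow> clause list \<Rightarrow> nogood list" where
  "clause_nogoods b k n cls = filter (\<lambda>q. \<exists>c \<in> set cls. nogood_falsifies b q c) (all_nogoods k n)"

lemma satisfiable_if_avoids_clause_nogoods: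
  assumes cnf: "is_3cnf (N, cls)" and group_less: "\<And>v. v < N \<Longrightarrow> v div b < k"
    and g_range: "g \<in> {..<k} \<rightarrow> {..<n}"
    and g_avoids: "\<And>q. q \<in> set (clause_nogoods b k n cls) \<Longrightarrow> avoids g q"
  shows "satisfiable (N, cls)"
proof -
  define \<alpha> where "\<alpha> v = bit (g (v div b)) (v mod b)" for v
  have "sat_clause \<alpha> c" if c_mem: "c \<in> set cls" for c
  proof (rule ccontr)
    obtain c\<^sub>1 v\<^sub>1 c\<^sub>2 v\<^sub>2 c\<^sub>3 v\<^sub>3 where c: "c = ((c\<^sub>1, v\<^sub>1), (c\<^sub>2, v\<^sub>2), (c\<^sub>3, v\<^sub>3))"
      by (metis surj_pair)
    let ?p = "\<lambda>v. (v div b, g (v div b))"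
    let ?q = "(?p v\<^sub>1, ?p v\<^sub>2, ?p v\<^sub>3)"
    assume "\<not> sat_clause \<alpha> c"
    then have "nogood_falsifies b ?q c" by (auto simp: c \<alpha>_def)
    moreover have "v\<^sub>1 < N" "v\<^sub>2 < N" "v\<^sub>3 < N" using cnf c_mem by (auto simp: is_3cnf_def c)
    then have "?q \<in> set (all_nogoods k n)" using g_range group_less by (auto simp: set_all_nogoods)
    ultimately have "?q \<in> set (clause_nogoods b k n cls)"
      using c_mem by (auto simp: clause_nogoods_def simp del: nogood_falsifies.simps)
    then have "avoids g ?q" by (rule g_avoids)
    then show False by simp
  qed
  then show ?thesis unfolding satisfiable_def snd_conv by blast
qed

lemma ex_avoids_clause_nogoods_if_satisfiable:
  assumes b_pos: "b > 0" and sat: "satisfiable (N, cls)"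
  shows "\<exists>g \<in> {..<k} \<rightarrow> {..<2 ^ b}. \<forall>q \<in> set (clause_nogoods b k n cls). avoids g q"
proof -
  obtain \<alpha> where \<alpha>: "\<And>c. c \<in> set cls \<Longrightarrow> sat_clause \<alpha> c"
    using sat by (auto simp: satisfiable_def)
  define g :: "nat \<Rightarrow> nat" where "g j = horner_sum of_bool 2 (map (\<lambda>p. \<alpha> (j * b + p)) [0..<b])" for j
  have bit_g: "bit (g (v div b)) (v mod b) = \<alpha> v" for v
    using b_pos by (simp add: g_def bit_horner_sum_bit_iff)
  have "g j < 2 ^ b" for j
    using horner_sum_of_bool_2_less[of "map (\<lambda>p. \<alpha> (j * b + p)) [0..<b]"] by (simp add: g_def)
  then have "g \<in> {..<k} \<rightarrow> {..<2 ^ b}" by simp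
  then show ?thesis
  proof (intro bexI ballI)
    fix q
    assume "q \<in> set (clause_nogoods b k n cls)"
    then obtain c where c_mem: "c \<in> set cls" and falsifies: "nogood_falsifies b q c"
      by (auto simp: clause_nogoods_def)
    obtain j\<^sub>1 i\<^sub>1 j\<^sub>2 i\<^sub>2 j\<^sub>3 i\<^sub>3 where q: "q = ((j\<^sub>1, i\<^sub>1), (j\<^sub>2, i\<^sub>2), (j\<^sub>3, i\<^sub>3))" by (metis surj_pair)
    obtain c\<^sub>1 v\<^sub>1 c\<^sub>2 v\<^sub>2 c\<^sub>3 v\<^sub>3 where c: "c = ((c\<^sub>1, v\<^sub>1), (c\<^sub>2, v\<^sub>2), (c\<^sub>3, v\<^sub>3))" by (metis surj_pair)
    show "avoids g q"
      using \<alpha>[OF c_mem] falsifies by (auto simp: q c bit_g)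
  qed
qed

lemma polytime_literals:
  "polytime enc_clause enc_literal (\<lambda>c. fst c)"
  "polytime enc_clause enc_literal (\<lambda>c. fst (snd c))"
  "polytime enc_clause enc_literal (\<lambda>c. snd (snd c))"
proof -
  have tuple: "polytime enc_clause
      (enc_pair enc_literal (enc_pair enc_literal (enc_pair enc_literal enc_unit)))
      (\<lambda>c. (fst c, fst (snd c), snd (snd c), ()))"
    using polytime_id
    by (rule polytime_recode) (auto simp: enc_pair_def simp del: enc_literal.simps)
  show "polytime enc_clause enc_literal (\<lambda>c. fst c)"
    using polytime_fst[OF tuple] by simp
  show "polytime enc_clause enc_literal (\<lambda>c. fst (snd c))"
    using polytime_fst[OF polytime_snd[OF tuple]] by simp
  show "polytime enc_clause enc_literal (\<lambda>c. snd (snd c))"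
    using polytime_fst[OF polytime_snd[OF polytime_snd[OF tuple]]] by simp
qed

lemma enc_literal_eq_enc_pair: "enc_literal = enc_pair enc_bool enc_nat"
  by (auto simp: enc_pair_def)

lemma polytime_slot_falsifies [polytime_intros]:
  assumes "polytime E enc_nat b" "polytime E enc_slot p" "polytime E enc_literal l"
  shows "polytime E enc_bool (\<lambda>x. slot_falsifies (b x) (p x) (l x))"
proof -
  have "slot_falsifies b p l \<longleftrightarrow> snd l div b = fst p \<and> \<not> (bit (snd p) (snd l mod b) = fst l)"
    for b p l
    by (cases p; cases l) simp
  then show ?thesis
    by (simp only:) (rule assms[unfolded enc_literal_eq_enc_pair] polytime_intros)+
qed

lemma polytime_nogood_falsifies [polytime_intros]:
  assumes "polytime E enc_nat b" "polytime E enc_nogood q" "polytime E enc_clause c"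
  shows "polytime E enc_bool (\<lambda>x. nogood_falsifies (b x) (q x) (c x))"
proof -
  have "nogood_falsifies b q c \<longleftrightarrow> slot_falsifies b (fst q) (fst c) \<and>
      slot_falsifies b (fst (snd q)) (fst (snd c)) \<and>
      slot_falsifies b (snd (snd q)) (snd (snd c))" for b q c
    by (cases q; cases c) simp
  then show ?thesis
    by (simp only:) (rule assms polytime_literals[THEN polytime_compose] polytime_intros)+
qed

lemma polytime_clause_nogoods [polytime_intros]:
  assumes "polytime E enc_nat b" "polytime E enc_nat k" "polytime E enc_nat n"
    "polytime E (enc_list enc_clause) cls"
  shows "polytime E (enc_list enc_nogood) (\<lambda>x. clause_nogoods (b x) (k x) (n x) (cls x))"
  unfolding clause_nogoods_def by (rule assms assms[THEN polytime_compose] polytime_intros)+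

section \<open>The reduction\<close>

definition group_size :: "nat \<Rightarrow> nat" where
  "group_size N = Suc (floor_log N div 2)"

definition num_groups :: "nat \<Rightarrow> nat" where
  "num_groups N = Suc (N div group_size N)"

definition sat3_nogoods :: "formula \<Rightarrow> nogood list" where
  "sat3_nogoods \<phi> =
     clause_nogoods (group_size (fst \<phi>)) (num_groups (fst \<phi>)) (2 ^ group_size (fst \<phi>)) (snd \<phi>)"

definition sat3_to_wsp :: "formula \<Rightarrow> listed_wsp" where
  "sat3_to_wsp \<phi> = nogood_wsp (num_groups (fst \<phi>)) (2 ^ group_size (fst \<phi>)) (sat3_nogoods \<phi>)"

definition reduction_tasks :: "nat \<Rightarrow> nat" where
  "reduction_tasks N = 3 * (num_groups N + 2 ^ group_size N)"

lemma less_power4_group_size: "N < 4 ^ group_size N"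
proof -
  have "N < 2 ^ Suc (floor_log N)" using floor_log_exp2_gt[of N] by simp
  also have "\<dots> \<le> 2 ^ (2 * group_size N)"
    unfolding group_size_def by (intro power_increasing) auto
  finally show ?thesis by (simp add: power_mult)
qed

lemma power4_group_size_le:
  assumes "N > 0"
  shows "4 ^ group_size N \<le> 4 * N"
proof -
  have "4 ^ group_size N = 4 * (2::nat) ^ (2 * (floor_log N div 2))"
    by (simp add: group_size_def power_mult)
  also have "(2::nat) ^ (2 * (floor_log N div 2)) \<le> 2 ^ floor_log N"
    by (intro power_increasing) auto
  also have "\<dots> \<le> N" using assms by (rule floor_log_exp2_le)
  finally show ?thesis by simp
qed

lemma distinct_sat3_nogoods: "distinct (sat3_nogoods \<phi>)"
  by (simp add: sat3_nogoods_def clause_nogoods_def distinct_all_nogoods)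

lemma set_sat3_nogoods_subset:
  "set (sat3_nogoods \<phi>) \<subseteq> set (all_nogoods (num_groups (fst \<phi>)) (2 ^ group_size (fst \<phi>)))"
  by (auto simp: sat3_nogoods_def clause_nogoods_def)

lemma sat3_to_wsp_in_ui_wsp_inputs:
  "(wsp_of (sat3_to_wsp \<phi>), enc_wsp (sat3_to_wsp \<phi>)) \<in> ui_wsp_inputs"
  unfolding sat3_to_wsp_def
  by (intro ui_wsp_inputsI ui_wsp_nogood_wsp distinct_sat3_nogoods set_sat3_nogoods_subset)

lemma tasks_sat3_to_wsp: "tasks (wsp_of (sat3_to_wsp \<phi>)) = {..<reduction_tasks (fst \<phi>)}"
  by (simp add: sat3_to_wsp_def nogood_wsp_def reduction_tasks_def)

lemma valid_complete_plan_sat3_to_wsp_iff: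
  assumes "is_3cnf \<phi>"
  shows "(\<exists>\<pi>. valid_complete_plan (wsp_of (sat3_to_wsp \<phi>)) \<pi>) \<longleftrightarrow> satisfiable \<phi>"
proof -
  obtain N cls where \<phi>: "\<phi> = (N, cls)" by (cases \<phi>)
  have "v div group_size N < num_groups N" if "v < N" for v
    using that by (simp add: num_groups_def less_Suc_eq_le div_le_mono)
  moreover have "group_size N > 0" by (simp add: group_size_def)
  ultimately have "(\<exists>g \<in> {..<num_groups N} \<rightarrow> {..<2 ^ group_size N}.
      \<forall>q \<in> set (sat3_nogoods \<phi>). avoids g q) \<longleftrightarrow> satisfiable \<phi>"
    using satisfiable_if_avoids_clause_nogoods[of N cls]
      ex_avoids_clause_nogoods_if_satisfiable[of _ N cls] assms
    unfolding \<phi> sat3_nogoods_def fst_conv snd_conv by blast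
  then show ?thesis
    unfolding sat3_to_wsp_def
      ex_valid_complete_plan_nogood_wsp_iff[OF distinct_sat3_nogoods set_sat3_nogoods_subset]
    by (simp add: \<phi>)
qed

lemma sat3_answer_if_wsp_answer:
  assumes "is_3cnf \<phi>" "wsp_answer (wsp_of (sat3_to_wsp \<phi>)) y"
  shows "sat3_answer \<phi> y"
  using assms(2) valid_complete_plan_sat3_to_wsp_iff[OF assms(1)]
  unfolding wsp_answer_def sat3_answer_def by (cases "satisfiable \<phi>") auto

lemma power2_group_size_le: "2 ^ group_size N \<le> 4 * N + 4"
proof (cases "N = 0")
  case False
  have "(2::nat) ^ group_size N \<le> 4 ^ group_size N" by (rule power_mono) simp_all
  with power4_group_size_le[of N] False show ?thesis by simp
qed (simp add: group_size_def)

lemma polytime_group_size [polytime_intros]: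
  "polytime E enc_nat N \<Longrightarrow> polytime E enc_nat (\<lambda>x. group_size (N x))"
  unfolding group_size_def by (rule polytime_intros | assumption)+

lemma polytime_power2_group_size [polytime_intros]:
  assumes "polytime E enc_nat N"
  shows "polytime E enc_nat (\<lambda>x. 2 ^ group_size (N x))"
proof -
  have "polytime E enc_nat (\<lambda>x. min (4 * N x + 4) (2 ^ group_size (N x)))"
    by (rule assms polytime_intros)+
  then show ?thesis by (simp add: min_absorb2 power2_group_size_le)
qed

lemma polytime_sat3_to_wsp: "polytime enc_formula enc_wsp sat3_to_wsp"
proof -
  have enc_formula: "enc_formula = enc_pair enc_nat (enc_list enc_clause)"
    by (simp add: fun_eq_iff enc_formula_def enc_pair_def)
  show ?thesis
    unfolding enc_formula sat3_to_wsp_def[abs_def] sat3_nogoods_def num_groups_def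
    by (rule polytime_intros)+
qed

lemma size_enc_list_le:
  "(\<And>x. x \<in> set xs \<Longrightarrow> size (f x) \<le> c) \<Longrightarrow> size (enc_list f xs) \<le> length xs * Suc c"
  by (induction xs) force+

lemma size_enc_formula_le:
  assumes "is_3cnf (N, cls)"
  shows "size (enc_formula (N, cls)) \<le> N + 1 + length cls * (3 * N + 10)"
proof -
  have literal: "size (enc_literal l) \<le> N + 2" if "snd l < N" for l
    using that by (cases l) (auto simp: enc_bool_def size_enc_nat)
  have "size (enc_clause c) \<le> 3 * N + 9" if "c \<in> set cls" for c
  proof -
    obtain l\<^sub>1 l\<^sub>2 l\<^sub>3 where c: "c = (l\<^sub>1, l\<^sub>2, l\<^sub>3)" by (cases c)
    then have "snd l\<^sub>1 < N" "snd l\<^sub>2 < N" "snd l\<^sub>3 < N" using assms that by (auto simp: is_3cnf_def)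
    from this[THEN literal] show ?thesis by (simp add: c del: enc_literal.simps)
  qed
  then have "size (enc_list enc_clause cls) \<le> length cls * Suc (3 * N + 9)"
    by (rule size_enc_list_le)
  then show ?thesis by (simp add: enc_formula_def size_enc_nat add.commute)
qed

section \<open>The number of tasks\<close>

lemma reduction_tasks_mult_group_size_le:
  assumes "N > 0"
  shows "reduction_tasks N * group_size N \<le> 27 * N"
proof -
  let ?b = "group_size N"
  have square: "2 ^ ?b * 2 ^ ?b \<le> 4 * N"
    using power4_group_size_le[OF assms] by (simp flip: power_mult_distrib)
  have "?b \<le> 2 ^ ?b" by (simp add: less_imp_le)
  then have users: "2 ^ ?b * ?b \<le> 4 * N"
    using square mult_le_mono2[of ?b "2 ^ ?b" "2 ^ ?b"] by linarith
  have "?b \<le> 2 ^ ?b * ?b" by simp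
  moreover have "num_groups N * ?b \<le> ?b + N" by (simp add: num_groups_def)
  ultimately have "num_groups N * ?b \<le> 5 * N" using users by linarith
  with users show ?thesis by (simp add: reduction_tasks_def algebra_simps)
qed

lemma reduction_tasks_mult_log_le:
  assumes "N > 0"
  shows "real (reduction_tasks N) * log 2 (real (reduction_tasks N)) \<le> 189 * real N"
proof -
  let ?b = "group_size N" and ?K = "reduction_tasks N"
  have b_ge_1: "?b \<ge> 1" by (simp add: group_size_def)
  note tasks_le = reduction_tasks_mult_group_size_le[OF assms]
  have "?K \<le> ?K * ?b" using b_ge_1 by simp
  also note tasks_le
  also have "27 * N \<le> 2 ^ 5 * 4 ^ ?b" using less_power4_group_size[of N] by simp
  also have "\<dots> = 2 ^ (5 + 2 * ?b)" by (simp add: power_add power_mult)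
  also have "\<dots> \<le> 2 ^ (7 * ?b)" using b_ge_1 by (intro power_increasing) auto
  finally have "real ?K \<le> 2 ^ (7 * ?b)" by (metis of_nat_le_iff of_nat_numeral of_nat_power)
  moreover have "?K > 0" by (simp add: reduction_tasks_def)
  ultimately have "log 2 (real ?K) \<le> real (7 * ?b)"
    by (subst log_le_iff) (simp_all add: powr_realpow del: of_nat_mult)
  then have "real ?K * log 2 (real ?K) \<le> real ?K * real (7 * ?b)"
    by (intro mult_left_mono) auto
  also have "\<dots> = 7 * real (?K * ?b)" by simp
  also have "\<dots> \<le> 7 * real (27 * N)"
    using tasks_le by (intro mult_left_mono) (simp_all only: of_nat_le_iff)
  finally show ?thesis by simp
qed

lemma filterlim_reduction_tasks: "filterlim reduction_tasks at_top sequentially"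
  unfolding filterlim_at_top eventually_sequentially
proof (intro allI exI impI)
  fix Z N :: nat
  assume "4 ^ Z \<le> N"
  then have "(4::nat) ^ Z < 4 ^ group_size N" using less_power4_group_size le_less_trans by blast
  then have "Z < group_size N" by (simp only: power_strict_increasing_iff)
  also have "\<dots> < 2 ^ group_size N" by simp
  also have "\<dots> \<le> reduction_tasks N" by (simp add: reduction_tasks_def)
  finally show "Z \<le> reduction_tasks N" by simp
qed

lemma smallo_reduction_tasks:
  assumes "f \<in> o(\<lambda>k::nat. real k * log 2 (real k))"
  shows "(\<lambda>N. \<bar>f (reduction_tasks N)\<bar>) \<in> o(\<lambda>N. real N)"
proof -
  let ?g = "\<lambda>N. real (reduction_tasks N) * log 2 (real (reduction_tasks N))"
  have "(\<lambda>N. f (reduction_tasks N)) \<in> o(?g)"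
    using landau_o.small.compose[OF assms filterlim_reduction_tasks] .
  moreover have "?g \<in> O(\<lambda>N. real N)"
  proof (rule landau_o.bigI)
    have "0 \<le> ?g N" for N
    proof -
      have "1 \<le> reduction_tasks N" by (simp add: reduction_tasks_def num_groups_def)
      then show ?thesis by simp
    qed
    then show "\<forall>\<^sub>F N in sequentially. norm (?g N) \<le> 189 * norm (real N)"
      using reduction_tasks_mult_log_le by (intro eventually_sequentiallyI[of 1]) simp
  qed simp
  ultimately have "(\<lambda>N. f (reduction_tasks N)) \<in> o(\<lambda>N. real N)"
    by (rule landau_o.small_big_trans)
  then show ?thesis by simp
qed

section \<open>The lower bound\<close>

lemma sat3_solvable_if_ui_wsp_solvable:
  assumes "solvable_in_Ostar ui_wsp_inputs wsp_answer
      {num_users, num_tasks, num_constraints, input_length} (\<lambda>i. 2 powr f (num_tasks i))"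
  shows "solvable_in_Ostar sat3_inputs sat3_answer {num_vars, num_clauses}
      (\<lambda>i. 2 powr \<bar>f (reduction_tasks (num_vars i))\<bar>)"
proof (rule solvable_in_size_imp_solvable_in_Ostar)
  have "solvable_in_size ui_wsp_inputs wsp_answer (\<lambda>i. 2 powr f (num_tasks i))"
    by (rule solvable_in_Ostar_imp_solvable_in_size[OF assms])
      (erule (1) ui_wsp_parameter_le_size, rule powr_ge_zero)
  then show "solvable_in_size sat3_inputs sat3_answer
      (\<lambda>i. 2 powr \<bar>f (reduction_tasks (num_vars i))\<bar>)"
  proof (rule solvable_in_size_reduction[OF polytime_sat3_to_wsp, rotated -1])
    fix \<phi> x
    assume "(\<phi>, x) \<in> sat3_inputs"
    then have \<phi>: "is_3cnf \<phi>" and x: "x = enc_formula \<phi>" by (auto simp: sat3_inputs_def)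
    show "x = enc_formula \<phi> \<and> (wsp_of (sat3_to_wsp \<phi>), enc_wsp (sat3_to_wsp \<phi>)) \<in> ui_wsp_inputs"
      using x sat3_to_wsp_in_ui_wsp_inputs by blast
    show "sat3_answer \<phi> y" if "wsp_answer (wsp_of (sat3_to_wsp \<phi>)) y" for y
      using \<phi> that by (rule sat3_answer_if_wsp_answer)
    show "2 powr f (num_tasks (wsp_of (sat3_to_wsp \<phi>), enc_wsp (sat3_to_wsp \<phi>)))
        \<le> 2 powr \<bar>f (reduction_tasks (num_vars (\<phi>, x)))\<bar>"
      by (simp add: num_tasks_def num_vars_def tasks_sat3_to_wsp)
  qed (simp add: ge_one_powr_ge_zero)
  let ?S = "\<lambda>i. num_vars i + 1 + num_clauses i * (3 * num_vars i + 10)"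
  show "polynomial_in {num_vars, num_clauses} (\<lambda>i. real (?S i))"
    unfolding of_nat_add of_nat_mult by (intro polynomial_in.intros) auto
  show "size x \<le> ?S (\<phi>, x)" if "(\<phi>, x) \<in> sat3_inputs" for \<phi> x
    using that size_enc_formula_le[of "fst \<phi>" "snd \<phi>"]
    by (auto simp: sat3_inputs_def num_vars_def num_clauses_def)
qed simp

theorem theorem18:
  assumes "ETH"
  shows "\<not> (\<exists>f \<in> o(\<lambda>k::nat. real k * log 2 (real k)).
            solvable_in_Ostar ui_wsp_inputs wsp_answer
              {num_users, num_tasks, num_constraints}
              (\<lambda>i. 2 powr f (num_tasks i)))
       \<and> \<not> (\<exists>f \<in> o(\<lambda>k::nat. real k * log 2 (real k)).
            solvable_in_Ostar ui_wsp_inputs wsp_answer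
              {num_users, num_tasks, num_constraints, input_length}
              (\<lambda>i. 2 powr f (num_tasks i)))"
proof -
  have "\<not> solvable_in_Ostar ui_wsp_inputs wsp_answer
      {num_users, num_tasks, num_constraints, input_length} (\<lambda>i. 2 powr f (num_tasks i))"
    if f_small: "f \<in> o(\<lambda>k::nat. real k * log 2 (real k))" for f
  proof
    assume "solvable_in_Ostar ui_wsp_inputs wsp_answer
      {num_users, num_tasks, num_constraints, input_length} (\<lambda>i. 2 powr f (num_tasks i))"
    from sat3_solvable_if_ui_wsp_solvable[OF this]
    have "\<exists>g \<in> o(\<lambda>N::nat. real N). solvable_in_Ostar sat3_inputs sat3_answer {num_vars, num_clauses}
        (\<lambda>i. 2 powr g (num_vars i))"
      using smallo_reduction_tasks[OF f_small] by (rule bexI)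
    with assms show False unfolding ETH_def by contradiction
  qed
  moreover have "{num_users, num_tasks, num_constraints} \<subseteq>
      {num_users, num_tasks, num_constraints, input_length}" by blast
  ultimately show ?thesis using solvable_in_Ostar_mono by blast
qed

end
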